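(* Let $n\ge 3$, let $C_n$ be the cycle on $n$ vertices, and let $\mathbf{x}\in\mathbb{R}^{V(C_n)}$. Then there is a matrix $A\in\mathcal{S}_L(C_n)$ such that $\mathbf{x}$ is an eigenvector of $A$ with respect to $\lambda_2(A)$ or $\lambda_3(A)$ if and only if $\mathbf{x}$ is periodic and balanced.
   Context: $\mathcal{S}_L(C_n)$ is the set of weighted Laplacian matrices of $C_n$: real symmetric matrices $A$ indexed by $V(C_n)$ whose off-diagonal $i,j$-entry is negative if $\{i,j\}\in E(C_n)$ and zero otherwise, with $A\mathbf{1}=\mathbf{0}$. $\lambda_k(A)$ is the $k$-th smallest eigenvalue, counted with multiplicity. The vertices of $C_n$ are labeled by $\mathbb{Z}_n=\{0,\dots,n-1\}$ following the cycle order (so the edges are $\{i,i+1\}$, indices mod $n$). Intervals are cyclic: $[i,j]=\{i,i+1,\dots,j\}$, $(i,j]=\{i+1,\dots,j\}$, $[i,j)=\{i,\dots,j-1\}$. For $\mathbf{x}=(x_i)\in\mathbb{R}^{V(C_n)}$ let $V_+,V_-,V_0$ be the sets of indices where $\mathbf{x}$ is positive, negative, zero, respectively, and let $C_n[S]$ be the subgraph induced on $S$. The vector $\mathbf{x}$ is periodic if $\mathbf{1}^\top\mathbf{x}=0$ and: 1. each of $C_n[V_+]$ and $C_n[V_-]$ is a (nonempty) path, while $C_n[V_0]$ is composed of isolated vertices with $0\le|V_0|\le2$; 2. along the path $C_n[V_+]$, the values of $\mathbf{x}$ are strictly increasing, followed by at most two maximum values (i.e. the maximum is attained at one vertex or at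 two consecutive vertices), and then strictly decreasing; 3. along the path $C_n[V_-]$, the values of $\mathbf{x}$ are strictly decreasing, followed by at most two minimum values (i.e. the minimum is attained at one vertex or at two consecutive vertices), and then strictly increasing. Let $\mathbf{x}$ be periodic. A vertex $i$ is a peak if $x_i=\max(\mathbf{x})$ and a valley if $x_i=\min(\mathbf{x})$. If $\mathbf{x}$ has a unique peak $p$, set $p'=p$; if it has two peaks $p,p+1$, set $p'=p+1$. If $\mathbf{x}$ has a unique valley $q$, set $q'=q$; if it has two valleys $q,q+1$, set $q'=q+1$. The vector $\mathbf{x}$ is balanced if $$\sum_{i\in(p,q]}x_i<0<\sum_{i\in[p',q')}x_i$$ when $\mathbf{x}$ has a unique peak or a unique valley, and $$\sum_{i\in(p,q]}x_i=0=\sum_{i\in[p',q')}x_i$$ when $\mathbf{x}$ has two peaks and two valleys. *)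

theory Defs
  imports "Jordan_Normal_Form.Char_Poly"
begin

text \<open>A simple graph is given by a vertex set and a set of edges, each edge being a two-element
  set of vertices. The cycle on \<open>n \<ge> 3\<close> vertices has vertex set \<open>{..<n}\<close>.\<close>

definition cycle_edges :: "nat \<Rightarrow> nat set set" where
  "cycle_edges n = {{i, (i + 1) mod n} |i. i < n}"

definition induced_edges :: "nat set set \<Rightarrow> nat set \<Rightarrow> nat set set" where
  "induced_edges E S = {e \<in> E. e \<subseteq> S}"

text \<open>The graph with vertex set \<open>S\<close> and edge set \<open>F\<close> is a nonempty path, and the list \<open>vs\<close>
  runs along this path from one end to the other. A single vertex is a path.\<close>

definition path_order :: "nat set \<Rightarrow> nat set set \<Rightarrow> nat list \<Rightarrow> bool" where
  "path_order S F vs \<longleftrightarrow> vs \<noteq> [] \<and> distinct vs \<and> set vs = S \<and>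
     F = {{vs ! i, vs ! Suc i} |i. Suc i < length vs}"

text \<open>Weighted Laplacian matrices of the graph with vertex set \<open>{..<n}\<close> and edge set \<open>E\<close>.\<close>

definition ones_vec :: "nat \<Rightarrow> real vec" where
  "ones_vec n = vec n (\<lambda>_. 1)"

definition weighted_laplacians :: "nat \<Rightarrow> nat set set \<Rightarrow> real mat set" where
  "weighted_laplacians n E = {A \<in> carrier_mat n n.
     transpose_mat A = A \<and>
     (\<forall>i<n. \<forall>j<n. i \<noteq> j \<longrightarrow> (if {i, j} \<in> E then A $$ (i, j) < 0 else A $$ (i, j) = 0)) \<and>
     A *\<^sub>v ones_vec n = 0\<^sub>v n}"

text \<open>The \<open>k\<close>-th smallest eigenvalue (\<open>k \<ge> 1\<close>), counted with multiplicity. This is meaningful for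
  real symmetric matrices of dimension at least \<open>k\<close>: all roots of the characteristic polynomial
  are then real and algebraic and geometric multiplicities agree.\<close>

definition kth_eigenvalue :: "nat \<Rightarrow> real mat \<Rightarrow> real" where
  "kth_eigenvalue k A = sorted_list_of_multiset (proots (char_poly A)) ! (k - 1)"

definition pos_set :: "nat \<Rightarrow> real vec \<Rightarrow> nat set" where
  "pos_set n x = {i. i < n \<and> x $ i > 0}"

definition neg_set :: "nat \<Rightarrow> real vec \<Rightarrow> nat set" where
  "neg_set n x = {i. i < n \<and> x $ i < 0}"

definition zero_set :: "nat \<Rightarrow> real vec \<Rightarrow> nat set" where
  "zero_set n x = {i. i < n \<and> x $ i = 0}"

text \<open>The list consists of a strictly increasing part, followed by one or two entries equal to the
  maximum \<open>m\<close>, followed by a strictly decreasing part; the increasing and the decreasing part may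
  be empty. The valley version is the same with the order reversed.\<close>

definition up_down :: "real list \<Rightarrow> bool" where
  "up_down ys \<longleftrightarrow> (\<exists>us m r ds. ys = us @ replicate r m @ ds \<and> r \<in> {1, 2} \<and>
     sorted_wrt (<) (us @ [m]) \<and> sorted_wrt (>) (m # ds))"

definition down_up :: "real list \<Rightarrow> bool" where
  "down_up ys \<longleftrightarrow> (\<exists>us m r ds. ys = us @ replicate r m @ ds \<and> r \<in> {1, 2} \<and>
     sorted_wrt (>) (us @ [m]) \<and> sorted_wrt (<) (m # ds))"

definition periodic :: "nat \<Rightarrow> real vec \<Rightarrow> bool" where
  "periodic n x \<longleftrightarrow>
     ones_vec n \<bullet> x = 0 \<and>
     (\<exists>vs. path_order (pos_set n x) (induced_edges (cycle_edges n) (pos_set n x)) vs \<and>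
           up_down (map (\<lambda>i. x $ i) vs)) \<and>
     (\<exists>vs. path_order (neg_set n x) (induced_edges (cycle_edges n) (neg_set n x)) vs \<and>
           down_up (map (\<lambda>i. x $ i) vs)) \<and>
     induced_edges (cycle_edges n) (zero_set n x) = {} \<and> card (zero_set n x) \<le> 2"

definition peaks :: "nat \<Rightarrow> real vec \<Rightarrow> nat set" where
  "peaks n x = {i. i < n \<and> x $ i = Max ((\<lambda>j. x $ j) ` {..<n})}"

definition valleys :: "nat \<Rightarrow> real vec \<Rightarrow> nat set" where
  "valleys n x = {i. i < n \<and> x $ i = Min ((\<lambda>j. x $ j) ` {..<n})}"

text \<open>The set \<open>S\<close> is either \<open>{a}\<close>, with \<open>a' = a\<close>, or \<open>{a, a + 1}\<close>, with \<open>a' = a + 1\<close>, where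
  addition is modulo \<open>n\<close>. For \<open>n \<ge> 3\<close> the set \<open>S\<close> determines \<open>a\<close> and \<open>a'\<close>.\<close>

definition first_last :: "nat \<Rightarrow> nat set \<Rightarrow> nat \<Rightarrow> nat \<Rightarrow> bool" where
  "first_last n S a a' \<longleftrightarrow> a < n \<and> S = {a, a'} \<and> (a' = a \<or> a' = (a + 1) mod n)"

text \<open>Cyclic half-open intervals; \<open>(j + n - i) mod n\<close> is the number of steps from \<open>i\<close> to \<open>j\<close>
  in the direction of increasing labels.\<close>

definition cyc_oc :: "nat \<Rightarrow> nat \<Rightarrow> nat \<Rightarrow> nat set" where
  "cyc_oc n i j = {(i + k) mod n |k. 0 < k \<and> k \<le> (j + n - i) mod n}"

definition cyc_co :: "nat \<Rightarrow> nat \<Rightarrow> nat \<Rightarrow> nat set" where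
  "cyc_co n i j = {(i + k) mod n |k. k < (j + n - i) mod n}"

text \<open>Intended for periodic \<open>x\<close> and \<open>n \<ge> 3\<close>, where \<open>p\<close>, \<open>p'\<close>, \<open>q\<close>, \<open>q'\<close> exist and are unique.\<close>

definition balanced :: "nat \<Rightarrow> real vec \<Rightarrow> bool" where
  "balanced n x \<longleftrightarrow> (\<exists>p p' q q'.
     first_last n (peaks n x) p p' \<and> first_last n (valleys n x) q q' \<and>
     (if card (peaks n x) = 1 \<or> card (valleys n x) = 1
      then (\<Sum>i\<in>cyc_oc n p q. x $ i) < 0 \<and> 0 < (\<Sum>i\<in>cyc_co n p' q'. x $ i)
      else (\<Sum>i\<in>cyc_oc n p q. x $ i) = 0 \<and> 0 = (\<Sum>i\<in>cyc_co n p' q'. x $ i)))"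

end

theory Submission
  imports Defs "Jordan_Normal_Form.Schur_Decomposition"
begin

text \<open>Write \<open>F i\<close> for the entry of \<open>x\<close> at vertex \<open>i mod n\<close> and \<open>w i > 0\<close> for the weight of the edge
  from \<open>i\<close> to \<open>i + 1\<close>. The equation \<open>A x = c x\<close> says that the flux
  \<open>D i = w i * (F (i + 1) - F i)\<close> satisfies \<open>D i - D (i + 1) = c * F (i + 1)\<close>. As the weights are
  arbitrary positive numbers, finding \<open>A\<close> for a given \<open>x\<close> and \<open>c = 1\<close> means finding a solution \<open>D\<close>
  of this recurrence that has on each edge the same sign as the increment of \<open>F\<close>.

  From eigenvector to shape. If \<open>c\<close> is the second or third eigenvalue, then the form of \<open>A - c\<close> is
  nonnegative on a subspace of codimension two. A discrete version of Courant's nodal domain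
  argument (\<open>no_four_sign_changes\<close>) then excludes that \<open>x\<close> shows the signs \<open>-, +, -, +\<close> in cyclic
  order: multiplying \<open>x\<close> by a step function that is constant on the nodal arcs makes the form
  nonpositive. Since the flux falls where \<open>x\<close> is positive and rises where \<open>x\<close> is negative, it
  changes sign only twice around the cycle, so \<open>x\<close> falls once and rises once
  (\<open>unimodal_if_two_sign_changes\<close>). With \<open>x\<close> orthogonal to the constants, this is what periodic
  means. The two sums in the definition of balanced telescope to differences of fluxes next to
  peaks and valleys, whose signs are known.

  From shape to eigenvector. Summing \<open>x\<close> gives the flux up to an additive constant. Balance is
  exactly the condition under which the constant can be chosen so that the flux has the right sign
  next to every peak and valley. The flux is convex or concave between a peak and a valley, in the
  direction that carries these signs over to all edges in between
  (\<open>flux_with_gradient_signs\<close>). The resulting Laplacian has \<open>x\<close> as eigenvector for the eigenvalue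
  1, and the form of \<open>A - 1\<close> is nonnegative on the vectors \<open>h x\<close> for which the factor \<open>h\<close> does not
  jump at the two sign changes of \<open>x\<close> (\<open>unimodal_energy_bound\<close>). These vectors have codimension
  two, so at most two eigenvalues lie below 1.

  Eigenvalues are counted as roots of the characteristic polynomial. An orthonormal eigenbasis
  whose eigenvalues are these roots (\<open>symmetric_eigenbasis\<close>) translates this count into statements
  about quadratic forms.\<close>

section \<open>The spectrum of a real symmetric matrix\<close>

text \<open>For an eigenvector \<open>v\<close> of \<open>a\<close> the number \<open>S = v\<^sup>* A v = a * |v|\<^sup>2\<close> is invariant under conjugation,
  because \<open>A\<close> is real and symmetric.\<close>

lemma symmetric_real_eigenvalue:
  fixes A :: "real mat"
  assumes A: "A \<in> carrier_mat n n" and sym: "transpose_mat A = A"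
    and ev: "eigenvector (map_mat complex_of_real A) v a"
  shows "a \<in> \<real>"
proof -
  from ev A have v: "v \<in> carrier_vec n" and v0: "v \<noteq> 0\<^sub>v n"
    and eq: "map_mat complex_of_real A *\<^sub>v v = a \<cdot>\<^sub>v v"
    unfolding eigenvector_def by auto
  have symA: "A $$ (i,j) = A $$ (j,i)" if "i < n" "j < n" for i j
    using arg_cong[OF sym, of "\<lambda>M. M $$ (i,j)"] that A by auto
  have row: "(\<Sum>j<n. of_real (A $$ (i,j)) * v $ j) = a * v $ i" if "i < n" for i
    using arg_cong[OF eq, of "\<lambda>u. u $ i"] that A v
    by (auto simp: scalar_prod_def lessThan_atLeast0)
  define S where "S = (\<Sum>i<n. \<Sum>j<n. of_real (A $$ (i,j)) * v $ j * cnj (v $ i))"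
  define N where "N = (\<Sum>i<n. (cmod (v $ i))\<^sup>2)"
  have "cnj S = (\<Sum>i<n. \<Sum>j<n. of_real (A $$ (i,j)) * cnj (v $ j) * v $ i)"
    by (simp add: S_def)
  also have "\<dots> = (\<Sum>j<n. \<Sum>i<n. of_real (A $$ (i,j)) * cnj (v $ j) * v $ i)"
    by (rule sum.swap)
  also have "\<dots> = S"
    unfolding S_def by (intro sum.cong refl) (simp add: symA ac_simps)
  finally have SR: "cnj S = S" .
  have "S = (\<Sum>i<n. (a * v $ i) * cnj (v $ i))"
    unfolding S_def by (intro sum.cong refl) (simp add: row[symmetric] sum_distrib_right)
  also have "\<dots> = a * of_real N"
    by (simp add: N_def sum_distrib_left mult.assoc complex_norm_square[symmetric])
  finally have SN: "S = a * of_real N" .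
  obtain i where i: "i < n" "v $ i \<noteq> 0"
    using v v0 by (metis carrier_vecD eq_vecI index_zero_vec)
  have "N > 0" unfolding N_def
    by (rule sum_pos2[of _ i]) (use i in auto)
  with SR SN have "cnj a = a" by simp
  thus ?thesis using Reals_cnj_iff by blast
qed

text \<open>Over the complex numbers the characteristic polynomial splits. All its roots are real, so the
  factorization descends along the injective embedding of the real polynomials.\<close>

lemma symmetric_char_poly_splits:
  fixes A :: "real mat"
  assumes A: "A \<in> carrier_mat n n" and sym: "transpose_mat A = A"
  obtains es where "char_poly A = (\<Prod>e\<leftarrow>es. [:- e, 1:])" "length es = n" "sorted es"
proof -
  let ?c = "complex_of_real"
  have cA: "map_mat ?c A \<in> carrier_mat n n" using A by auto
  from char_poly_factorized[OF cA] obtain as where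
    as: "char_poly (map_mat ?c A) = (\<Prod>a\<leftarrow>as. [:- a, 1:])" "length as = n" by blast
  have real: "a \<in> \<real>" if "a \<in> set as" for a
  proof -
    have "eigenvalue (map_mat ?c A) a"
      unfolding eigenvalue_root_char_poly[OF cA] as(1) poly_prod_list
      using that by (auto simp: prod_list_zero_iff intro!: image_eqI[of _ _ a])
    thus ?thesis using symmetric_real_eigenvalue[OF A sym] unfolding eigenvalue_def by blast
  qed
  define es where "es = sort (map Re as)"
  interpret c: map_poly_inj_idom_hom ?c ..
  have "map_poly ?c (char_poly A) = (\<Prod>a\<leftarrow>as. [:- a, 1:])"
    using as(1) of_real_hom.char_poly_hom[OF A, where ?'a = complex] by simp
  also have "\<dots> = (\<Prod>a\<leftarrow>as. map_poly ?c [:- Re a, 1:])"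
  proof (rule arg_cong[of _ _ prod_list], rule map_cong[OF refl])
    fix a assume "a \<in> set as"
    thus "[:- a, 1:] = map_poly ?c [:- Re a, 1:]" using real by (auto simp: complex_is_Real_iff complex_eq_iff)
  qed
  also have "\<dots> = map_poly ?c (\<Prod>a\<leftarrow>map Re as. [:- a, 1:])"
    by (simp add: c.hom_prod_list o_def)
  finally have "char_poly A = (\<Prod>a\<leftarrow>map Re as. [:- a, 1:])" by simp
  also have "\<dots> = (\<Prod>e\<leftarrow>es. [:- e, 1:])"
    unfolding es_def by (simp only: prod_mset_prod_list[symmetric] mset_map mset_sort)
  finally show thesis using that[of es] as(2) by (auto simp: es_def)
qed

text \<open>Complete \<open>v\<close> to a basis, apply the Gram-Schmidt process, which keeps \<open>v\<close> as its first vector, and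
  normalize the columns.\<close>

lemma orthogonal_mat_first_col:
  fixes v :: "real vec"
  assumes v: "v \<in> carrier_vec n" and v0: "v \<noteq> 0\<^sub>v n"
  obtains W c where "W \<in> carrier_mat n n" "transpose_mat W * W = 1\<^sub>m n" "col W 0 = c \<cdot>\<^sub>v v"
proof -
  interpret cof_vec_space n "TYPE(real)" .
  note bc = basis_completion[OF v v0]
  define ws where "ws = gram_schmidt n (basis_completion v)"
  note gs = gram_schmidt_result[OF bc(2) bc(4) bc(5) ws_def]
  have n0: "0 < n" using v v0 by (cases n) auto
  have len: "length ws = n" using gs(4) bc(6) by simp
  have "hd ws = v"
    using gram_schmidt_hd[OF v, of "tl (basis_completion v)"] bc(7) bc(6) n0
    unfolding ws_def by (cases "basis_completion v") auto
  hence hd: "ws ! 0 = v" using len n0 by (cases ws) auto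
  have ws: "ws ! i \<in> carrier_vec n" if "i < n" for i using gs(3) len that by auto
  have orth: "(ws ! i \<bullet> ws ! j = 0) = (i \<noteq> j)" if "i < n" "j < n" for i j
    using corthogonalD[OF gs(2), of i j] that len ws by (simp add: conjugate_real_def)
  have pos: "ws ! i \<bullet> ws ! i > 0" if "i < n" for i
    using orth[OF that that] conjugate_square_ge_0_vec[of "ws ! i"] by (simp add: conjugate_real_def)
  define W where "W = mat_of_cols n (map (\<lambda>w. (1 / sqrt (w \<bullet> w)) \<cdot>\<^sub>v w) ws)"
  have W: "W \<in> carrier_mat n n" unfolding W_def using len by auto
  have colW: "col W i = (1 / sqrt (ws ! i \<bullet> ws ! i)) \<cdot>\<^sub>v ws ! i" if "i < n" for i
    unfolding W_def using that len ws[OF that] by (subst col_mat_of_cols) auto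
  have "transpose_mat W * W = 1\<^sub>m n"
  proof (rule eq_matI)
    fix i j assume ij: "i < dim_row (1\<^sub>m n)" "j < dim_col (1\<^sub>m n)"
    hence ij: "i < n" "j < n" by auto
    have "(transpose_mat W * W) $$ (i,j) = col W i \<bullet> col W j" using ij W by auto
    also have "\<dots> = 1\<^sub>m n $$ (i,j)" 
      using ij ws[OF ij(1)] ws[OF ij(2)] orth[OF ij] pos[OF ij(1)]
      by (auto simp: colW real_div_sqrt)
    finally show "(transpose_mat W * W) $$ (i,j) = 1\<^sub>m n $$ (i,j)" .
  qed (use W in auto)
  thus thesis using that[OF W, of "1 / sqrt (v \<bullet> v)"] colW[OF n0] hd by simp
qed

text \<open>Deflation: an orthogonal change of basis that starts with an eigenvector for the first root splits
  off a \<open>1 \<times> 1\<close> block. By symmetry both off-diagonal blocks vanish, so the remaining block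
  is symmetric and its characteristic polynomial is the product over the remaining roots. Since the
  order of the list \<open>es\<close> is kept, the diagonal can be sorted in advance.\<close>

lemma symmetric_diagonalization:
  fixes A :: "real mat"
  assumes "A \<in> carrier_mat n n" "transpose_mat A = A" "char_poly A = (\<Prod>e\<leftarrow>es. [:- e, 1:])"
  shows "\<exists>P \<in> carrier_mat n n. transpose_mat P * P = 1\<^sub>m n \<and>
           transpose_mat P * A * P = mat_diag n (\<lambda>i. es ! i)"
  using assms
proof (induction es arbitrary: n A)
  case Nil
  with degree_monic_char_poly[of A n] have "n = 0" by auto
  with Nil(1) show ?case by (intro bexI[of _ "1\<^sub>m 0"]) (auto simp: mat_diag_def)
next
  case (Cons e es)
  note A = Cons.prems(1) and sym = Cons.prems(2)
  define m where "m = n - 1"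
  have cp: "char_poly A = [: -e, 1 :] * (\<Prod>e \<leftarrow> es. [:- e, 1:])" using Cons.prems(3) by simp
  have "degree (char_poly A) \<noteq> 0" unfolding cp
    by (subst degree_mult_eq) (auto simp: prod_list_zero_iff)
  with degree_monic_char_poly[OF A] have n: "n = 1 + m" unfolding m_def by simp
  have "eigenvalue A e" unfolding eigenvalue_root_char_poly[OF A] cp by simp
  then obtain v where v: "v \<in> carrier_vec n" "v \<noteq> 0\<^sub>v n" and ev: "A *\<^sub>v v = e \<cdot>\<^sub>v v"
    using A unfolding eigenvalue_def eigenvector_def by auto
  obtain W c where W: "W \<in> carrier_mat n n" and WW: "transpose_mat W * W = 1\<^sub>m n"
    and colW: "col W 0 = c \<cdot>\<^sub>v v"
    using orthogonal_mat_first_col[OF v] .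
  let ?Wt = "transpose_mat W"
  have Wt: "?Wt \<in> carrier_mat n n" using W by auto
  have WW': "W * ?Wt = 1\<^sub>m n" using mat_mult_left_right_inverse[OF Wt W WW] .
  define B where "B = ?Wt * A * W"
  have B: "B \<in> carrier_mat n n" unfolding B_def using W A by auto
  have symB: "transpose_mat B = B"
    unfolding B_def using W Wt A sym by (simp add: transpose_mult[of _ n n _ n] assoc_mult_mat[of _ n n _ n _ n])
  have symB': "B $$ (i,j) = B $$ (j,i)" if "i < n" "j < n" for i j
    using arg_cong[OF symB, of "\<lambda>M. M $$ (i,j)"] that B by auto
  have "col B 0 = ?Wt *\<^sub>v (A *\<^sub>v col W 0)"
  proof -
    have "B = ?Wt * (A * W)" unfolding B_def using Wt A W by (rule assoc_mult_mat)
    thus ?thesis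
      using col_mult2[OF Wt mult_carrier_mat[OF A W], of 0] col_mult2[OF A W, of 0] n
      by (simp only: zero_less_Suc plus_1_eq_Suc)
  qed
  also have "\<dots> = e \<cdot>\<^sub>v (?Wt *\<^sub>v col W 0)"
    using A v Wt by (simp add: colW ev mult_mat_vec[of _ n n] smult_smult_assoc mult.commute)
  also have "?Wt *\<^sub>v col W 0 = col (1\<^sub>m n) 0"
    using col_mult2[OF Wt W, of 0] n by (simp add: WW)
  finally have colB: "col B 0 = e \<cdot>\<^sub>v unit_vec n 0" using n by simp
  have B0: "B $$ (i,0) = (if i = 0 then e else 0)" if "i < n" for i
    using arg_cong[OF colB, of "\<lambda>u. u $ i"] that B n by auto
  define B3 where "B3 = mat m m (\<lambda>(i,j). B $$ (Suc i, Suc j))"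
  have B3: "B3 \<in> carrier_mat m m" unfolding B3_def by auto
  have symB3: "transpose_mat B3 = B3"
    unfolding B3_def by (rule eq_matI) (auto simp: n symB')
  let ?e = "mat 1 1 (\<lambda>_. e)"
  have Bblock: "B = four_block_mat ?e (0\<^sub>m 1 m) (0\<^sub>m m 1) B3"
    by (rule eq_matI) (use B n symB'[of 0] B0 in \<open>auto simp: B3_def\<close>)
  have "similar_mat B A"
    unfolding similar_mat_def similar_mat_wit_def Let_def
    using A B W Wt WW WW' by (intro exI[of _ ?Wt] exI[of _ W]) (auto simp: B_def)
  hence "char_poly B = char_poly A" by (rule char_poly_similar)
  moreover have "char_poly B = char_poly ?e * char_poly B3" unfolding Bblock
    by (rule char_poly_four_block_zeros_col[OF _ _ B3]) auto
  moreover have "char_poly ?e = [: -e,1 :]"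
    by (simp add: char_poly_defs det_def sign_def)
  ultimately have "[: -e,1 :] * char_poly B3 = [: -e,1 :] * (\<Prod>e \<leftarrow> es. [:- e, 1:])"
    using cp by simp
  hence cp3: "char_poly B3 = (\<Prod>e \<leftarrow> es. [:- e, 1:])"
    by (metis mult_cancel_left pCons_eq_0_iff zero_neq_one)
  from Cons.IH[OF B3 symB3 cp3] obtain U where U: "U \<in> carrier_mat m m"
    and UU: "transpose_mat U * U = 1\<^sub>m m"
    and UBU: "transpose_mat U * B3 * U = mat_diag m (\<lambda>i. es ! i)" by blast
  define V where "V = four_block_mat (1\<^sub>m 1) (0\<^sub>m 1 m) (0\<^sub>m m 1) U"
  have V: "V \<in> carrier_mat n n" unfolding V_def n using U by auto
  have Vt: "transpose_mat V = four_block_mat (1\<^sub>m 1) (0\<^sub>m 1 m) (0\<^sub>m m 1) (transpose_mat U)"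
    unfolding V_def by (subst transpose_four_block_mat[of _ 1 1 _ m _ m]) (use U in auto)
  have Ut: "transpose_mat U \<in> carrier_mat m m" using U by auto
  have VtC: "transpose_mat V \<in> carrier_mat n n" using V by auto
  have VV: "transpose_mat V * V = 1\<^sub>m n"
    unfolding Vt unfolding V_def
    by (subst mult_four_block_mat[of _ 1 1 _ m _ m]) (use U Ut UU in \<open>auto simp: n four_block_one_mat\<close>)
  have VB: "transpose_mat V * B = four_block_mat ?e (0\<^sub>m 1 m) (0\<^sub>m m 1) (transpose_mat U * B3)"
    unfolding Vt Bblock
    by (subst mult_four_block_mat[of _ 1 1 _ m _ m]) (use U Ut B3 in \<open>auto simp: right_add_zero_mat left_add_zero_mat\<close>)
  have VBV: "transpose_mat V * B * V = mat_diag n (\<lambda>i. (e # es) ! i)"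
  proof -
    have "transpose_mat V * B * V = four_block_mat ?e (0\<^sub>m 1 m) (0\<^sub>m m 1) (mat_diag m (\<lambda>i. es ! i))"
      unfolding VB unfolding V_def
      by (subst mult_four_block_mat[of _ 1 1 _ m _ m]) (use U Ut B3 UBU in auto)
    also have "\<dots> = mat_diag n (\<lambda>i. (e # es) ! i)"
      by (rule eq_matI) (auto simp: n mat_diag_def nth_Cons')
    finally show ?thesis .
  qed
  show ?case
  proof (intro bexI conjI)
    show "W * V \<in> carrier_mat n n" using W V by auto
    have t: "transpose_mat (W * V) = transpose_mat V * ?Wt"
      using W V by (rule transpose_mult)
    have "transpose_mat (W * V) * (W * V) = transpose_mat V * (?Wt * W) * V"
      unfolding t using W Wt V VtC by (simp add: assoc_mult_mat[of _ n n _ n _ n])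
    thus "transpose_mat (W * V) * (W * V) = 1\<^sub>m n" using WW VV VtC by simp
    have "transpose_mat (W * V) * A * (W * V) = transpose_mat V * B * V"
      unfolding t B_def using W Wt V VtC A by (simp add: assoc_mult_mat[of _ n n _ n _ n])
    thus "transpose_mat (W * V) * A * (W * V) = mat_diag n (\<lambda>i. (e # es) ! i)"
      using VBV by simp
  qed
qed


lemma kth_eigenvalue_char_poly:
  assumes cp: "char_poly A = (\<Prod>e\<leftarrow>es. [:- e, 1:])" and "sorted es"
  shows "kth_eigenvalue (Suc k) A = es ! k"
proof -
  have "proots (char_poly A) = mset es"
    unfolding cp
  proof (induction es)
    case (Cons e es)
    have "(\<Prod>e\<leftarrow>es. [:- e, 1:]) \<noteq> 0" by (auto simp: prod_list_zero_iff)
    thus ?case using Cons by (simp add: proots_mult del: mult_pCons_left)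
  qed simp
  thus ?thesis
    unfolding kth_eigenvalue_def using sorted_sort_id[OF assms(2)] by simp
qed

lemma symmetric_eigenbasis:
  assumes A: "A \<in> carrier_mat n n" and sym: "transpose_mat A = A"
  obtains P where "P \<in> carrier_mat n n" "transpose_mat P * P = 1\<^sub>m n"
    "A * P = P * mat_diag n (\<lambda>i. kth_eigenvalue (Suc i) A)"
    "\<forall>i j. i \<le> j \<longrightarrow> j < n \<longrightarrow> kth_eigenvalue (Suc i) A \<le> kth_eigenvalue (Suc j) A"
    "\<forall>a. eigenvalue A a \<longrightarrow> (\<exists>i<n. a = kth_eigenvalue (Suc i) A)"
proof -
  obtain es where es: "char_poly A = (\<Prod>e\<leftarrow>es. [:- e, 1:])" "length es = n" "sorted es"
    using symmetric_char_poly_splits[OF assms] .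
  note kth = kth_eigenvalue_char_poly[OF es(1,3)]
  obtain P where P: "P \<in> carrier_mat n n" and PP: "transpose_mat P * P = 1\<^sub>m n"
    and PAP: "transpose_mat P * A * P = mat_diag n (\<lambda>i. es ! i)"
    using symmetric_diagonalization[OF assms es(1)] by blast
  have Pt: "transpose_mat P \<in> carrier_mat n n" using P by auto
  have PP': "P * transpose_mat P = 1\<^sub>m n" using mat_mult_left_right_inverse[OF Pt P PP] .
  have "A * P = (P * transpose_mat P) * A * P" using A P by (simp add: PP')
  also have "\<dots> = P * mat_diag n (\<lambda>i. es ! i)"
    unfolding PAP[symmetric] using A P Pt by (simp add: assoc_mult_mat[of _ n n _ n _ n])
  finally have AP: "A * P = P * mat_diag n (\<lambda>i. es ! i)" .
  have ev: "\<exists>i<n. a = kth_eigenvalue (Suc i) A" if "eigenvalue A a" for a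
    using that unfolding eigenvalue_root_char_poly[OF A] es(1) poly_prod_list
    by (auto simp: prod_list_zero_iff kth in_set_conv_nth es(2))
  show thesis
    using that[OF P PP] AP ev es(2,3) by (simp add: kth sorted_iff_nth_mono)
qed

text \<open>In the coordinates \<open>z\<close> of an orthonormal eigenbasis, both quadratic forms are diagonal.\<close>

lemma eigenbasis_quadratic_form:
  fixes P :: "real mat"
  assumes A: "A \<in> carrier_mat n n" and P: "P \<in> carrier_mat n n"
    and PP: "transpose_mat P * P = 1\<^sub>m n" and AP: "A * P = P * mat_diag n \<mu>"
    and z: "z \<in> carrier_vec n"
  shows "(P *\<^sub>v z) \<bullet> (A *\<^sub>v (P *\<^sub>v z)) = (\<Sum>k<n. \<mu> k * (z $ k)\<^sup>2)"
    and "(P *\<^sub>v z) \<bullet> (P *\<^sub>v z) = (\<Sum>k<n. (z $ k)\<^sup>2)"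
    and "A *\<^sub>v (P *\<^sub>v z) = P *\<^sub>v vec n (\<lambda>k. \<mu> k * z $ k)"
proof -
  have Pt: "transpose_mat P \<in> carrier_mat n n" using P by auto
  have iso: "(P *\<^sub>v u) \<bullet> (P *\<^sub>v v) = u \<bullet> v" if "u \<in> carrier_vec n" "v \<in> carrier_vec n" for u v
  proof -
    have "(P *\<^sub>v u) \<bullet> (P *\<^sub>v v) = (transpose_mat P *\<^sub>v (P *\<^sub>v u)) \<bullet> v"
      using transpose_vec_mult_scalar[OF P that(2), of "P *\<^sub>v u"] that P by simp
    also have "transpose_mat P *\<^sub>v (P *\<^sub>v u) = u"
      using that P Pt PP by (simp add: assoc_mult_mat_vec[of _ n n _ n, symmetric] del: assoc_mult_mat_vec)
    finally show ?thesis .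
  qed
  have D: "mat_diag n \<mu> *\<^sub>v z = vec n (\<lambda>k. \<mu> k * z $ k)"
    by (rule eq_vecI) (use z in \<open>auto simp: mat_diag_def scalar_prod_def if_distrib[of "\<lambda>x. x * _"] cong: if_cong\<close>)
  show Az: "A *\<^sub>v (P *\<^sub>v z) = P *\<^sub>v vec n (\<lambda>k. \<mu> k * z $ k)"
  proof -
    have "A *\<^sub>v (P *\<^sub>v z) = (A * P) *\<^sub>v z" using A P z by (simp only: assoc_mult_mat_vec)
    also have "\<dots> = P *\<^sub>v (mat_diag n \<mu> *\<^sub>v z)"
      unfolding AP using P z by (intro assoc_mult_mat_vec[of _ n n _ n]) auto
    finally show ?thesis unfolding D .
  qed
  show "(P *\<^sub>v z) \<bullet> (A *\<^sub>v (P *\<^sub>v z)) = (\<Sum>k<n. \<mu> k * (z $ k)\<^sup>2)"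
    unfolding Az using z
    by (subst iso) (auto simp: scalar_prod_def power2_eq_square lessThan_atLeast0 intro!: sum.cong)
  show "(P *\<^sub>v z) \<bullet> (P *\<^sub>v z) = (\<Sum>k<n. (z $ k)\<^sup>2)"
    using z by (subst iso) (auto simp: scalar_prod_def power2_eq_square lessThan_atLeast0)
qed

text \<open>Orthogonality to the first \<open>m\<close> basis vectors removes all coordinates whose eigenvalue might be
  below \<open>c\<close>. In the case of equality only the coordinates with eigenvalue exactly \<open>c\<close> remain; this is
  the step that turns a test vector into an eigenvector.\<close>

lemma rayleigh_lower_bound:
  fixes P :: "real mat"
  assumes A: "A \<in> carrier_mat n n" and P: "P \<in> carrier_mat n n"
    and PP: "transpose_mat P * P = 1\<^sub>m n" and AP: "A * P = P * mat_diag n \<mu>"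
    and mu: "\<And>k. m \<le> k \<Longrightarrow> k < n \<Longrightarrow> c \<le> \<mu> k"
    and y: "y \<in> carrier_vec n" and orth: "\<And>k. k < m \<Longrightarrow> k < n \<Longrightarrow> col P k \<bullet> y = 0"
  shows "y \<bullet> (A *\<^sub>v y) \<ge> c * (y \<bullet> y)"
    and "y \<bullet> (A *\<^sub>v y) = c * (y \<bullet> y) \<Longrightarrow> A *\<^sub>v y = c \<cdot>\<^sub>v y"
proof -
  have Pt: "transpose_mat P \<in> carrier_mat n n" using P by auto
  have PP': "P * transpose_mat P = 1\<^sub>m n" using mat_mult_left_right_inverse[OF Pt P PP] .
  define z where "z = transpose_mat P *\<^sub>v y"
  have z: "z \<in> carrier_vec n" using Pt y unfolding z_def by auto
  have yz: "y = P *\<^sub>v z"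
    unfolding z_def using P Pt y PP' by (simp add: assoc_mult_mat_vec[of _ n n _ n, symmetric] del: assoc_mult_mat_vec)
  have z0: "z $ k = 0" if "k < m" "k < n" for k
    using orth[OF that] that P unfolding z_def by auto
  note q = eigenbasis_quadratic_form[OF A P PP AP z, folded yz]
  have diff: "y \<bullet> (A *\<^sub>v y) - c * (y \<bullet> y) = (\<Sum>k<n. (\<mu> k - c) * (z $ k)\<^sup>2)"
    unfolding q(1,2) by (simp add: sum_distrib_left sum_subtractf left_diff_distrib)
  have termnn: "(\<mu> k - c) * (z $ k)\<^sup>2 \<ge> 0" if "k < n" for k
    using mu[of k] z0[of k] that by (cases "k < m") auto
  show "y \<bullet> (A *\<^sub>v y) \<ge> c * (y \<bullet> y)"
    using sum_nonneg[of "{..<n}" "\<lambda>k. (\<mu> k - c) * (z $ k)\<^sup>2"] termnn diff by auto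
  assume "y \<bullet> (A *\<^sub>v y) = c * (y \<bullet> y)"
  hence "(\<Sum>k<n. (\<mu> k - c) * (z $ k)\<^sup>2) = 0" using diff by simp
  hence "(\<mu> k - c) * (z $ k)\<^sup>2 = 0" if "k < n" for k
    using sum_nonneg_eq_0_iff[of "{..<n}" "\<lambda>k. (\<mu> k - c) * (z $ k)\<^sup>2"] termnn that by auto
  hence "vec n (\<lambda>k. \<mu> k * z $ k) = c \<cdot>\<^sub>v z"
    using z by (intro eq_vecI) auto
  thus "A *\<^sub>v y = c \<cdot>\<^sub>v y"
    unfolding q(3) using P z by (simp add: mult_mat_vec[of _ n n] yz)
qed

lemma rayleigh_upper_bound:
  fixes P :: "real mat"
  assumes A: "A \<in> carrier_mat n n" and P: "P \<in> carrier_mat n n"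
    and PP: "transpose_mat P * P = 1\<^sub>m n" and AP: "A * P = P * mat_diag n \<mu>"
    and mu: "\<And>k. k < n \<Longrightarrow> z $ k \<noteq> 0 \<Longrightarrow> \<mu> k \<le> c" and z: "z \<in> carrier_vec n"
  shows "(P *\<^sub>v z) \<bullet> (A *\<^sub>v (P *\<^sub>v z)) \<le> c * ((P *\<^sub>v z) \<bullet> (P *\<^sub>v z))"
  unfolding eigenbasis_quadratic_form(1,2)[OF A P PP AP z] sum_distrib_left
proof (rule sum_mono)
  fix k assume "k \<in> {..<n}"
  thus "\<mu> k * (z $ k)\<^sup>2 \<le> c * (z $ k)\<^sup>2"
    using mu[of k] by (cases "z $ k = 0") (auto intro: mult_right_mono)
qed

section \<open>Functions on a cycle\<close>

text \<open>A function on the vertices of the cycle, written as an \<open>n\<close>-periodic function on all natural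
  numbers. An arc that passes the vertex 0 is then an ordinary interval.\<close>

definition cyclic :: "nat \<Rightarrow> (nat \<Rightarrow> 'a) \<Rightarrow> bool" where
  "cyclic n F \<longleftrightarrow> (\<forall>i. F (i + n) = F i)"

lemma cyclicI: "(\<And>i. F (i + n) = F i) \<Longrightarrow> cyclic n F"
  by (simp add: cyclic_def)

lemma cyclicD: "cyclic n F \<Longrightarrow> F (i + n) = F i"
  by (simp add: cyclic_def)

lemma cyclic_add_mult:
  fixes F :: "nat \<Rightarrow> 'a"
  assumes cyc: "cyclic n F"
  shows "F (i + k * n) = F i"
proof (induction k)
  case (Suc k)
  thus ?case using cyclicD[OF cyc, of "i + k * n"] by (simp add: ac_simps)
qed simp

lemma cyclic_mod:
  fixes F :: "nat \<Rightarrow> 'a"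
  assumes cyc: "cyclic n F"
  shows "F (i mod n) = F i"
  using cyclic_add_mult[of n F "i mod n" "i div n", OF cyc] by simp

lemma cyclic_cong: "cyclic n F \<Longrightarrow> i mod n = j mod n \<Longrightarrow> F i = F j"
  by (metis cyclic_mod)

lemma window_representative:
  fixes n i b :: nat
  assumes "0 < n"
  obtains k where "k < n" "i mod n = (b + k) mod n"
proof
  have "b \<le> b * n" using assms by simp
  hence "i + b * n = b + (i + b * n - b)" by linarith
  hence "i mod n = (b + (i + b * n - b)) mod n" by (metis mod_mult_self1)
  thus "i mod n = (b + (i + b * n - b) mod n) mod n" by (simp add: mod_simps)
qed (use assms in simp)

lemma window_unique:
  fixes n a s t :: nat
  assumes "(a + s) mod n = (a + t) mod n" "s < n" "t < n"
  shows "s = t"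
  using assms
proof (induction s t rule: linorder_wlog)
  case (le s t)
  hence "n dvd (a + t) - (a + s)" by (subst mod_eq_dvd_iff_nat[symmetric]) auto
  thus ?case using le by (auto dest!: dvd_imp_le)
qed simp

lemma sum_cyclic_Suc:
  fixes G :: "nat \<Rightarrow> real"
  assumes cyc: "cyclic n G"
  shows "(\<Sum>i<n. G (Suc i)) = (\<Sum>i<n. G i)"
  using sum.lessThan_Suc_shift[of G n] cyclicD[OF cyc, of 0] by simp

lemma sum_cyclic_shift:
  fixes G :: "nat \<Rightarrow> real"
  assumes cyc: "cyclic n G"
  shows "(\<Sum>k<n. G (a + k)) = (\<Sum>k<n. G k)"
proof (induction a)
  case (Suc a)
  have "(\<Sum>k<n. G (Suc a + k)) = (\<Sum>k<n. G (a + Suc k))" by simp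
  also have "\<dots> = (\<Sum>k<n. G (a + k))"
    by (rule sum_cyclic_Suc[of n "\<lambda>k. G (a + k)"]) (rule cyclicI, metis cyclicD[OF cyc] add.assoc)
  finally show ?case using Suc by simp
qed simp

text \<open>The eigenvalue equation at vertex \<open>i + 1\<close>, with both neighbours reached without subtraction. For
  cyclic \<open>w\<close> and \<open>F\<close> these equations cover all vertices.\<close>

definition cycle_eigenfunction :: "(nat \<Rightarrow> real) \<Rightarrow> real \<Rightarrow> (nat \<Rightarrow> real) \<Rightarrow> bool" where
  "cycle_eigenfunction w c F \<longleftrightarrow>
     (\<forall>i. w i * (F (Suc i) - F i) - w (Suc i) * (F (Suc (Suc i)) - F (Suc i)) = c * F (Suc i))"

text \<open>Substituting \<open>h F\<close> with an eigenfunction \<open>F\<close> into the form of \<open>A - c\<close> leaves only the jumps of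
  \<open>h\<close>, and the sign of each term is that of \<open>F i * F (i + 1)\<close>. So jumps of \<open>h\<close> inside a nodal
  domain increase the form, and jumps between nodal domains of opposite signs decrease it.\<close>

lemma ground_state_identity:
  fixes F h w :: "nat \<Rightarrow> real"
  assumes cycF: "cyclic n F" and cycw: "cyclic n w"
    and cych: "cyclic n h" and eig: "cycle_eigenfunction w c F"
  shows "(\<Sum>i<n. w i * (h (Suc i) * F (Suc i) - h i * F i)\<^sup>2) - c * (\<Sum>i<n. (h i * F i)\<^sup>2)
       = (\<Sum>i<n. w i * (F i * F (Suc i)) * (h i - h (Suc i))\<^sup>2)"
proof -
  note perF = cyclicD[OF cycF] and perh = cyclicD[OF cych]
  note per = perF perh cyclicD[OF cycw] perF[of "Suc _", simplified] perh[of "Suc _", simplified]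
  let ?D = "\<lambda>i. w i * (F (Suc i) - F i)"
  have "c * (\<Sum>i<n. (h i * F i)\<^sup>2) = c * (\<Sum>i<n. (h (Suc i) * F (Suc i))\<^sup>2)"
    using sum_cyclic_Suc[of n "\<lambda>i. (h i * F i)\<^sup>2"] by (simp add: cyclic_def per)
  also have "\<dots> = (\<Sum>i<n. (h (Suc i))\<^sup>2 * F (Suc i) * (c * F (Suc i)))"
    by (simp add: sum_distrib_left power2_eq_square algebra_simps)
  also have "\<dots> = (\<Sum>i<n. (h (Suc i))\<^sup>2 * F (Suc i) * ?D i - (h (Suc i))\<^sup>2 * F (Suc i) * ?D (Suc i))"
    using eig unfolding cycle_eigenfunction_def
    by (intro sum.cong refl) (simp add: right_diff_distrib[symmetric])
  also have "\<dots> = (\<Sum>i<n. (h (Suc i))\<^sup>2 * F (Suc i) * ?D i) - (\<Sum>i<n. (h i)\<^sup>2 * F i * ?D i)"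
    using sum_cyclic_Suc[of n "\<lambda>i. (h i)\<^sup>2 * F i * ?D i"] by (simp add: cyclic_def per sum_subtractf)
  finally have "(\<Sum>i<n. w i * (h (Suc i) * F (Suc i) - h i * F i)\<^sup>2) - c * (\<Sum>i<n. (h i * F i)\<^sup>2)
    = (\<Sum>i<n. w i * (h (Suc i) * F (Suc i) - h i * F i)\<^sup>2
        - ((h (Suc i))\<^sup>2 * F (Suc i) * ?D i - (h i)\<^sup>2 * F i * ?D i))"
    by (simp add: sum_subtractf)
  also have "\<dots> = (\<Sum>i<n. w i * (F i * F (Suc i)) * (h i - h (Suc i))\<^sup>2)"
    by (intro sum.cong refl) (simp add: power2_eq_square algebra_simps)
  finally show ?thesis .
qed

text \<open>The eigenvalue equation is a recurrence of second order, so two adjacent values determine all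
  others.\<close>

lemma eigenfunction_zero_propagation:
  fixes F w :: "nat \<Rightarrow> real"
  assumes cyc: "cyclic n F" and n: "0 < n" and pos: "\<And>i. 0 < w i"
    and eig: "cycle_eigenfunction w c F" and zero: "F a = 0" "F (Suc a) = 0"
  shows "F i = 0"
proof -
  have *: "F (a + k) = 0 \<and> F (Suc (a + k)) = 0" for k
  proof (induction k)
    case (Suc k)
    have "w (Suc (a + k)) * F (Suc (Suc (a + k))) = 0"
      using eig[unfolded cycle_eigenfunction_def, rule_format, of "a + k"] Suc by simp
    thus ?case using Suc pos[of "Suc (a + k)"] by auto
  qed (use zero in auto)
  have "a \<le> i + a * n" using n by (simp add: trans_le_add2)
  hence "F (i + a * n) = 0" using *[of "i + a * n - a"] by simp
  thus ?thesis using cyclic_add_mult[OF cyc] by simp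
qed

lemma sign_change_between:
  fixes F :: "nat \<Rightarrow> real"
  assumes "a < b" "F a < 0" "0 < F b"
  obtains s where "a \<le> s" "s < b" "F s * F (Suc s) \<le> 0"
proof -
  define s where "s = (LEAST k. a \<le> k \<and> 0 \<le> F (Suc k))"
  have "a \<le> b - 1 \<and> 0 \<le> F (Suc (b - 1))" using assms by auto
  note s = LeastI[of "\<lambda>k. a \<le> k \<and> 0 \<le> F (Suc k)", OF this]
    and Least_le[of "\<lambda>k. a \<le> k \<and> 0 \<le> F (Suc k)", OF this]
  have "F s < 0"
  proof (cases "s = a")
    case False
    hence "a \<le> s - 1" "s - 1 < s" "Suc (s - 1) = s" using s(1) unfolding s_def[symmetric] by auto
    thus ?thesis using not_less_Least[of "s - 1" "\<lambda>k. a \<le> k \<and> 0 \<le> F (Suc k)"]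
      unfolding s_def[symmetric] by auto
  qed (use assms in auto)
  moreover have "a \<le> s" "0 \<le> F (Suc s)" "s \<le> b - 1"
    using s Least_le[of "\<lambda>k. a \<le> k \<and> 0 \<le> F (Suc k)" "b - 1"] assms unfolding s_def[symmetric] by auto
  ultimately show thesis using that[of s] assms(1) by (simp add: mult_nonpos_nonneg)
qed

text \<open>The cross product of the two coefficient vectors is a solution. If it vanishes, the two equations
  are proportional.\<close>

lemma two_linear_equations_three_unknowns:
  fixes a b c a' b' c' :: real
  obtains x y z where "x \<noteq> 0 \<or> y \<noteq> 0 \<or> z \<noteq> 0"
    "a * x + b * y + c * z = 0" "a' * x + b' * y + c' * z = 0"
proof -
  consider "b * c' - c * b' \<noteq> 0 \<or> c * a' - a * c' \<noteq> 0 \<or> a * b' - b * a' \<noteq> 0"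
    | "b * c' = c * b'" "c * a' = a * c'" "a * b' = b * a'" by fastforce
  thus thesis
  proof cases
    case 1
    thus ?thesis
      by (rule that[of "b * c' - c * b'" "c * a' - a * c'" "a * b' - b * a'"]) (simp_all add: algebra_simps)
  next
    case 2
    show ?thesis
    proof (cases "a = 0 \<and> a' = 0")
      case True
      thus ?thesis by (intro that[of 1 0 0]) auto
    next
      case False
      show ?thesis
      proof (cases "a = 0")
        case True
        with False 2 show ?thesis by (intro that[of "-b'" "a'" 0]) auto
      next
        case False
        with 2 show ?thesis by (intro that[of "-b" "a" 0]) (auto simp: algebra_simps)
      qed
    qed
  qed
qed

text \<open>Courant's argument. Cut the cycle at four places where \<open>F\<close> changes sign, and let \<open>h\<close> be constant
  on each of the four arcs, with value 0 on the first and \<open>\<alpha>\<close>, \<open>\<beta>\<close>, \<open>\<gamma>\<close> on the others. By the ground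
  state identity the form of \<open>A - c\<close> at \<open>h F\<close> is a sum of nonpositive terms. Three free values
  suffice to make \<open>h F\<close> orthogonal to \<open>U\<close> and \<open>V\<close>, where the form is nonnegative. Hence the form
  vanishes there, \<open>h F\<close> is itself an eigenfunction, and every term of the sum is zero. Because \<open>h\<close>
  vanishes on the first arc, \<open>h F\<close> has two adjacent zeros and is identically zero.\<close>

lemma no_four_sign_changes:
  fixes F w U V :: "nat \<Rightarrow> real"
  assumes cycF: "cyclic n F" and cycw: "cyclic n w" and pos: "\<And>i. 0 < w i"
    and eig: "cycle_eigenfunction w c F"
    and rayleigh: "\<And>y. cyclic n y \<Longrightarrow> (\<Sum>i<n. U i * y i) = 0 \<Longrightarrow> (\<Sum>i<n. V i * y i) = 0 \<Longrightarrow>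
       c * (\<Sum>i<n. (y i)\<^sup>2) \<le> (\<Sum>i<n. w i * (y (Suc i) - y i)\<^sup>2)"
    and rayleigh_eq: "\<And>y. cyclic n y \<Longrightarrow> (\<Sum>i<n. U i * y i) = 0 \<Longrightarrow> (\<Sum>i<n. V i * y i) = 0 \<Longrightarrow>
       c * (\<Sum>i<n. (y i)\<^sup>2) = (\<Sum>i<n. w i * (y (Suc i) - y i)\<^sup>2) \<Longrightarrow> cycle_eigenfunction w c y"
    and idx: "i1 < i2" "i2 < i3" "i3 < i4" "i4 < i1 + n"
    and sgn: "F i1 < 0" "0 < F i2" "F i3 < 0" "0 < F i4"
  shows False
proof -
  have n: "0 < n" using idx by auto
  obtain s1 where s1: "i1 \<le> s1" "s1 < i2" "F s1 * F (Suc s1) \<le> 0"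
    using sign_change_between[of i1 i2 F] idx sgn by auto
  obtain s2 where s2: "i2 \<le> s2" "s2 < i3" "F s2 * F (Suc s2) \<le> 0"
    using sign_change_between[of i2 i3 "\<lambda>i. - F i"] idx sgn by auto
  obtain s3 where s3: "i3 \<le> s3" "s3 < i4" "F s3 * F (Suc s3) \<le> 0"
    using sign_change_between[of i3 i4 F] idx sgn by auto
  obtain s4 where s4: "i4 \<le> s4" "s4 < i1 + n" "F s4 * F (Suc s4) \<le> 0"
    using sign_change_between[of i4 "i1 + n" "\<lambda>i. - F i"] idx sgn cyclicD[OF cycF, of i1] by auto
  \<comment> \<open>The representative of \<open>i\<close> in the window from \<open>i1\<close> to \<open>i1 + n - 1\<close>; the summand
    \<open>i1 * n - i1\<close> is \<open>- i1\<close> modulo \<open>n\<close>.\<close>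
  define rep where "rep i = i1 + (i + (i1 * n - i1)) mod n" for i
  have le: "i1 \<le> i1 * n" using n by simp
  have rep_window: "rep i = i" if "i1 \<le> i" "i < i1 + n" for i
  proof -
    have "i + (i1 * n - i1) = (i - i1) + i1 * n" using that le by linarith
    hence "(i + (i1 * n - i1)) mod n = i - i1" using that by (simp only: mod_mult_self1) simp
    thus ?thesis unfolding rep_def using that by simp
  qed
  have rep_per: "rep (i + n) = rep i" for i
    unfolding rep_def by (metis add.assoc add.commute mod_add_self2)
  have rep_end: "rep (i1 + n) = i1" using rep_per[of i1] rep_window[of i1] n by simp
  define arc where "arc lo hi i = (if lo < rep i \<and> rep i \<le> hi then 1 else 0 :: real)" for lo hi i
  have arc_per: "arc lo hi (i + n) = arc lo hi i" for lo hi i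
    unfolding arc_def rep_per ..
  let ?u = "\<lambda>lo hi i. arc lo hi i * F i"
  obtain \<alpha> \<beta> \<gamma> where nz: "\<alpha> \<noteq> 0 \<or> \<beta> \<noteq> 0 \<or> \<gamma> \<noteq> 0"
    and lin: "(\<Sum>i<n. U i * ?u s1 s2 i) * \<alpha> + (\<Sum>i<n. U i * ?u s2 s3 i) * \<beta> + (\<Sum>i<n. U i * ?u s3 s4 i) * \<gamma> = 0"
      "(\<Sum>i<n. V i * ?u s1 s2 i) * \<alpha> + (\<Sum>i<n. V i * ?u s2 s3 i) * \<beta> + (\<Sum>i<n. V i * ?u s3 s4 i) * \<gamma> = 0"
    by (rule two_linear_equations_three_unknowns)
  define h where "h i = \<alpha> * arc s1 s2 i + \<beta> * arc s2 s3 i + \<gamma> * arc s3 s4 i" for i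
  define y where "y i = h i * F i" for i
  have cych: "cyclic n h" unfolding cyclic_def h_def arc_per by simp
  have cycy: "cyclic n y" unfolding cyclic_def y_def cyclicD[OF cych] cyclicD[OF cycF] by simp
  have orth: "(\<Sum>i<n. U i * y i) = 0" "(\<Sum>i<n. V i * y i) = 0"
    using lin unfolding y_def h_def
    by (simp_all add: sum.distrib sum_distrib_left algebra_simps)
  have hval: "h i = (if i \<le> s1 then 0 else if i \<le> s2 then \<alpha> else if i \<le> s3 then \<beta>
      else if i \<le> s4 then \<gamma> else 0)" if "i1 \<le> i" "i \<le> i1 + n" for i
  proof (cases "i = i1 + n")
    case True
    thus ?thesis using s1 s2 s3 s4 idx unfolding h_def arc_def by (auto simp: rep_end)
  next
    case False
    hence "rep i = i" using that by (intro rep_window) auto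
    thus ?thesis using s1 s2 s3 s4 idx unfolding h_def arc_def by auto
  qed
  let ?T = "\<lambda>i. w i * (F i * F (Suc i)) * (h i - h (Suc i))\<^sup>2"
  have cycT: "cyclic n ?T"
    using cyclicD[OF cych, of "Suc _"] cyclicD[OF cycF, of "Suc _"]
    by (intro cyclicI) (simp add: cyclicD[OF cych] cyclicD[OF cycF] cyclicD[OF cycw])
  have T_le: "?T (i1 + k) \<le> 0" if "k < n" for k
  proof (cases "i1 + k \<in> {s1, s2, s3, s4}")
    case True
    hence "F (i1 + k) * F (Suc (i1 + k)) \<le> 0" using s1 s2 s3 s4 by auto
    hence "w (i1 + k) * (F (i1 + k) * F (Suc (i1 + k))) \<le> 0"
      using pos[of "i1 + k"] by (simp add: mult_nonneg_nonpos)
    thus ?thesis by (rule mult_nonpos_nonneg) simp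
  next
    case False
    hence "h (i1 + k) = h (Suc (i1 + k))"
      using that by (subst (1 2) hval) auto
    thus ?thesis by simp
  qed
  have energy: "(\<Sum>i<n. w i * (y (Suc i) - y i)\<^sup>2) - c * (\<Sum>i<n. (y i)\<^sup>2) = (\<Sum>k<n. ?T (i1 + k))"
    unfolding y_def ground_state_identity[OF cycF cycw cych eig]
    by (rule sum_cyclic_shift[OF cycT, symmetric])
  have "(\<Sum>k<n. ?T (i1 + k)) = 0"
    using energy rayleigh[OF cycy orth] sum_nonpos[of "{..<n}" "\<lambda>k. ?T (i1 + k)"] T_le by auto
  hence T0: "?T (i1 + k) = 0" if "k < n" for k
    using sum_nonneg_eq_0_iff[of "{..<n}" "\<lambda>k. - ?T (i1 + k)"] T_le that by (simp add: sum_negf)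
  have eig_y: "cycle_eigenfunction w c y"
    using rayleigh_eq[OF cycy orth] energy \<open>(\<Sum>k<n. ?T (i1 + k)) = 0\<close> by simp
  have y1: "y i1 = 0" using hval[of i1] s1 unfolding y_def by simp
  \<comment> \<open>If the first arc ends at \<open>i1\<close>, the vanishing jump term across its end forces \<open>h\<close> or \<open>F\<close> to be
    zero at the next vertex.\<close>
  have y2: "y (Suc i1) = 0"
  proof (cases "s1 = i1")
    case True
    have "h i1 = 0" using hval[of i1] s1 by simp
    with T0[of 0] n sgn pos[of i1] show ?thesis unfolding y_def by auto
  next
    case False
    thus ?thesis using hval[of "Suc i1"] s1 idx unfolding y_def by auto
  qed
  have y0: "y i = 0" for i
    using eigenfunction_zero_propagation[OF cycy n pos eig_y y1 y2] .
  have "\<alpha> = 0" using y0[of i2] hval[of i2] s1 s2 idx sgn unfolding y_def by auto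
  moreover have "\<beta> = 0" using y0[of i3] hval[of i3] s1 s2 s3 idx sgn unfolding y_def by auto
  moreover have "\<gamma> = 0" using y0[of i4] hval[of i4] s1 s2 s3 s4 idx sgn unfolding y_def by auto
  ultimately show False using nz by simp
qed


text \<open>Going once around the cycle from \<open>b\<close>, the function strictly decreases along \<open>j\<close> edges, is constant
  along \<open>e \<le> 1\<close> edges, strictly increases up to \<open>b + n - d\<close>, and is constant along the
  last \<open>d \<le> 1\<close> edges. In the notation for peaks and valleys, \<open>b\<close> is \<open>p'\<close>, \<open>b + n - d\<close>
  is \<open>p\<close>, \<open>b + j\<close> is \<open>q\<close> and \<open>b + j + e\<close> is \<open>q'\<close>.\<close>

definition unimodal_from :: "nat \<Rightarrow> (nat \<Rightarrow> real) \<Rightarrow> nat \<Rightarrow> nat \<Rightarrow> nat \<Rightarrow> nat \<Rightarrow> bool" where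
  "unimodal_from n F b j e d \<longleftrightarrow> 0 < j \<and> e \<le> 1 \<and> d \<le> 1 \<and> j + e + d < n \<and>
     (\<forall>k<j. F (Suc (b + k)) < F (b + k)) \<and>
     (e = 1 \<longrightarrow> F (Suc (b + j)) = F (b + j)) \<and>
     (\<forall>k. j + e \<le> k \<and> k < n - d \<longrightarrow> F (b + k) < F (Suc (b + k))) \<and>
     (d = 1 \<longrightarrow> F (b + n) = F (b + (n - 1)))"

lemma eigenfunction_sum_zero:
  fixes F w :: "nat \<Rightarrow> real"
  assumes cycF: "cyclic n F" and cycw: "cyclic n w"
    and eig: "cycle_eigenfunction w c F" and c: "c \<noteq> 0"
  shows "(\<Sum>i<n. F i) = 0"
proof -
  let ?D = "\<lambda>i. w i * (F (Suc i) - F i)"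
  have "c * (\<Sum>i<n. F (Suc i)) = (\<Sum>i<n. ?D i - ?D (Suc i))"
    using eig unfolding cycle_eigenfunction_def by (simp add: sum_distrib_left)
  also have "\<dots> = 0"
    using sum_cyclic_Suc[of n ?D] cyclicD[OF cycF, of "Suc _"]
    by (simp add: cyclicD[OF cycF] cyclicD[OF cycw] cyclic_def sum_subtractf)
  finally show ?thesis using c sum_cyclic_Suc[OF cycF] by simp
qed

lemma cyclic_max_attained:
  fixes F :: "nat \<Rightarrow> real"
  assumes cyc: "cyclic n F" and n: "0 < n"
  obtains b where "\<And>i. F i \<le> F b"
proof -
  have "finite (F ` {..<n})" "F ` {..<n} \<noteq> {}" using n by auto
  from Max_in[OF this] obtain b where b: "Max (F ` {..<n}) = F b" by auto
  have "F i \<le> F b" for i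
  proof -
    have "F (i mod n) \<le> Max (F ` {..<n})" using n by (intro Max_ge) auto
    thus ?thesis using cyclic_mod[OF cyc] b by simp
  qed
  thus thesis by (rule that)
qed

lemma increasing_on_interval:
  fixes F :: "nat \<Rightarrow> 'a :: order"
  assumes "\<And>i. a \<le> i \<Longrightarrow> i < b \<Longrightarrow> F i < F (Suc i)" and "a < b"
  shows "F a < F b"
  using assms(2,1) by (induction a b rule: less_Suc_induct) (auto intro: less_trans)

lemma nondecreasing_on_interval:
  fixes F :: "nat \<Rightarrow> 'a :: order"
  assumes "\<And>i. a \<le> i \<Longrightarrow> i < b \<Longrightarrow> F i \<le> F (Suc i)" and "a \<le> b"
  shows "F a \<le> F b"
  using assms(2,1) by (induction b rule: dec_induct) (auto intro: order_trans)

lemma strict_descent_exists: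
  fixes F :: "nat \<Rightarrow> real"
  assumes "a < b" "F b < F a"
  obtains i where "a \<le> i" "i < b" "F (Suc i) < F i"
proof (rule ccontr)
  assume "\<not> thesis"
  with that have up: "F i \<le> F (Suc i)" if "a \<le> i" "i < b" for i
    using that by (meson not_less)
  have "F a \<le> F b"
    by (rule nondecreasing_on_interval) (use up assms(1) in auto)
  thus False using assms by simp
qed

text \<open>Start at the last vertex \<open>b\<close> of a plateau of maxima, where the flux \<open>g\<close> is negative. The flux falls
  across a vertex exactly where \<open>F > 0\<close> and rises exactly where \<open>F < 0\<close>. If it became positive twice
  before returning to \<open>b\<close>, then there would be vertices with signs \<open>-, +, -, +\<close> in this order. A zero flux
  occurs on at most one edge at a time, since the two ends of such an edge have the same nonzero
  value and the flux keeps moving in the same direction.\<close>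

lemma unimodal_if_two_sign_changes:
  fixes F w :: "nat \<Rightarrow> real"
  assumes cycF: "cyclic n F" and cycw: "cyclic n w" and pos: "\<And>i. 0 < w i"
    and eig: "cycle_eigenfunction w c F" and c: "0 < c" and nz: "F i0 \<noteq> 0"
    and no4: "\<And>i1 i2 i3 i4. i1 < i2 \<Longrightarrow> i2 < i3 \<Longrightarrow> i3 < i4 \<Longrightarrow> i4 < i1 + n \<Longrightarrow>
       F i1 < 0 \<Longrightarrow> 0 < F i2 \<Longrightarrow> F i3 < 0 \<Longrightarrow> 0 < F i4 \<Longrightarrow> False" and n: "0 < n"
  obtains b j e d where "unimodal_from n F b j e d"
proof -
  have sum0: "(\<Sum>i<n. F i) = 0" using eigenfunction_sum_zero[OF cycF cycw eig] c by simp
  obtain b0 where b0: "\<And>i. F i \<le> F b0" using cyclic_max_attained[OF cycF n] by blast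
  obtain k0 where k0: "F (b0 + k0) < F b0"
  proof (rule ccontr)
    assume "\<not> thesis"
    hence const: "F (b0 + k) = F b0" for k using \<open>\<not> thesis\<close> that[of k] b0[of "b0 + k"] by argo
    have "(\<Sum>k<n. F (b0 + k)) = 0" using sum_cyclic_shift[OF cycF, of b0] sum0 by simp
    hence z: "F b0 = 0" using const n by simp
    have "b0 \<le> i0 + b0 * n" using n by (simp add: trans_le_add2)
    hence "F (i0 + b0 * n) = 0" using const[of "i0 + b0 * n - b0"] z by simp
    thus False using cyclic_add_mult[OF cycF] nz by simp
  qed
  have "\<exists>k. F (b0 + k) = F b0 \<and> F (Suc (b0 + k)) < F b0"
  proof (rule ccontr)
    assume "\<not> ?thesis"
    hence step: "F (b0 + k) = F b0 \<Longrightarrow> F (Suc (b0 + k)) = F b0" for k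
      using b0[of "Suc (b0 + k)"] by force
    have "F (b0 + k) = F b0" for k by (induction k) (use step in auto)
    thus False using k0 by simp
  qed
  then obtain b where max: "\<And>i. F i \<le> F b" and desc: "F (Suc b) < F b"
    using b0 by metis
  define g where "g k = w (b + k) * (F (Suc (b + k)) - F (b + k))" for k
  have g_neg: "g k < 0 \<longleftrightarrow> F (Suc (b + k)) < F (b + k)" and g_pos: "0 < g k \<longleftrightarrow> F (b + k) < F (Suc (b + k))"
    and g_zero: "g k = 0 \<longleftrightarrow> F (Suc (b + k)) = F (b + k)" for k
    using pos[of "b + k"] unfolding g_def by (auto simp: zero_less_mult_iff mult_less_0_iff)
  have step: "g k - g (Suc k) = c * F (Suc (b + k))" for k
    using eig unfolding cycle_eigenfunction_def g_def by simp
  have F_neg: "F (Suc (b + k)) < 0" if "g k < g (Suc k)" for k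
    using step[of k] that c by (metis diff_less_0_iff_less mult_less_0_iff not_less_iff_gr_or_eq)
  have F_pos: "F (Suc (b + k)) > 0" if "g (Suc k) < g k" for k
    using step[of k] that c by (metis diff_gt_0_iff_gt zero_less_mult_iff not_less_iff_gr_or_eq)
  have g0: "g 0 < 0" using desc g_neg[of 0] by simp
  have gn: "g n < 0" using g0 cyclicD[OF cycF, of b] cyclicD[OF cycF, of "Suc b"] cyclicD[OF cycw, of b] unfolding g_def by simp
  have rise: "\<exists>i. k < i \<and> i \<le> k' \<and> F (b + i) < 0" if lt: "g k < g k'" "k < k'" for k k'
  proof -
    obtain i where "k \<le> i" "i < k'" "- g (Suc i) < - g i"
      using strict_descent_exists[of k k' "\<lambda>i. - g i"] lt by (metis neg_less_iff_less)
    thus ?thesis using F_neg[of i] by (intro exI[of _ "Suc i"]) auto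
  qed
  have fall: "\<exists>i. k < i \<and> i \<le> k' \<and> 0 < F (b + i)" if lt: "g k' < g k" "k < k'" for k k'
  proof -
    obtain i where "k \<le> i" "i < k'" "g (Suc i) < g i"
      using strict_descent_exists[of k k' g] lt by blast
    thus ?thesis using F_pos[of i] by (intro exI[of _ "Suc i"]) auto
  qed
  have ex_j: "\<exists>k<n. 0 \<le> g k"
  proof (rule ccontr)
    assume neg: "\<not> ?thesis"
    have "- F (b + 0) < - F (b + n)"
    proof (rule increasing_on_interval[of 0 n "\<lambda>k. - F (b + k)"])
      fix k assume "k < n"
      with neg have "g k < 0" by (meson not_less)
      thus "- F (b + k) < - F (b + Suc k)" using g_neg[of k] by simp
    qed (rule n)
    thus False using cyclicD[OF cycF, of b] by simp
  qed
  define j where "j = (LEAST k. 0 \<le> g k)"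
  have gj: "0 \<le> g j" unfolding j_def by (rule LeastI_ex) (use ex_j in blast)
  have jn: "j < n" unfolding j_def using ex_j Least_le[of "\<lambda>k. 0 \<le> g k"] by (meson le_less_trans)
  have before_j: "g k < 0" if "k < j" for k
    using not_less_Least[of k "\<lambda>k. 0 \<le> g k"] that unfolding j_def by auto
  have j0: "0 < j" using gj g0 by (cases j) auto
  define e where "e = (if g j = 0 then 1 else 0 :: nat)"
  have g_je: "0 < g (j + e)"
  proof (cases "g j = 0")
    case True
    have "F (b + j) < 0" using F_neg[of "j - 1"] before_j[of "j - 1"] True j0 by simp
    hence "F (Suc (b + j)) < 0" using True g_zero[of j] by simp
    hence "c * F (Suc (b + j)) < 0" using c by (simp add: mult_pos_neg)
    thus ?thesis using step[of j] True unfolding e_def by simp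
  qed (use gj in \<open>auto simp: e_def\<close>)
  have jen: "j + e < n" using g_je gn jn unfolding e_def by (cases "j + e = n") (auto simp: e_def split: if_splits)
  define m where "m = (LEAST k. j + e \<le> k \<and> g k \<le> 0)"
  have ex_m: "j + e \<le> n \<and> g n \<le> 0" using gn jen by simp
  have m: "j + e \<le> m" "g m \<le> 0" using LeastI[of "\<lambda>k. j + e \<le> k \<and> g k \<le> 0", OF ex_m] unfolding m_def by auto
  have mn: "m \<le> n" unfolding m_def using ex_m by (rule Least_le)
  have jem: "j + e < m" using m g_je by (cases "j + e = m") auto
  have before_m: "0 < g k" if "j + e \<le> k" "k < m" for k
    using not_less_Least[of k "\<lambda>k. j + e \<le> k \<and> g k \<le> 0"] that unfolding m_def by auto
  define d where "d = (if g m = 0 then 1 else 0 :: nat)"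
  have g_md: "g (m + d) < 0"
  proof (cases "g m = 0")
    case True
    have "g m < g (m - 1)" using before_m[of "m - 1"] jem True by simp
    hence "0 < F (b + m)" using F_pos[of "m - 1"] jem by simp
    hence "0 < F (Suc (b + m))" using True g_zero[of m] by simp
    hence "0 < c * F (Suc (b + m))" using c by simp
    thus ?thesis using step[of m] True unfolding d_def by simp
  qed (use m in \<open>auto simp: d_def\<close>)
  have mdn: "m + d \<le> n" using mn gn unfolding d_def by (cases "m = n") auto
  have "m + d = n"
  proof (rule ccontr)
    assume "m + d \<noteq> n"
    hence lt: "m + d < n" using mdn by simp
    show False
    proof (cases "\<exists>k. m + d < k \<and> k < n \<and> 0 < g k")
      case True
      then obtain k where k: "m + d < k" "k < n" "0 < g k" by blast
      obtain i1 where i1: "0 < i1" "i1 \<le> j + e" "F (b + i1) < 0"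
        using rise[of 0 "j + e"] g0 g_je j0 by auto
      obtain i2 where i2: "j + e < i2" "i2 \<le> m + d" "0 < F (b + i2)"
        using fall[of "m + d" "j + e"] g_md g_je jem by auto
      obtain i3 where i3: "m + d < i3" "i3 \<le> k" "F (b + i3) < 0"
        using rise[of "m + d" k] g_md k by auto
      obtain i4 where i4: "k < i4" "i4 \<le> n" "0 < F (b + i4)"
        using fall[of n k] gn k by auto
      show False
        by (rule no4[of "b + i1" "b + i2" "b + i3" "b + i4"]) (use i1 i2 i3 i4 in auto)
    next
      case False
      have "k \<le> n - Suc (m + d) \<Longrightarrow> F (b + Suc (m + d) + k) \<le> F (b + Suc (m + d))" for k
      proof (induction k)
        case (Suc k)
        have "\<not> 0 < g (Suc (m + d) + k)" using False Suc.prems by force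
        thus ?case using Suc g_pos[of "Suc (m + d) + k"] by (simp add: add.assoc)
      qed simp
      from this[of "n - Suc (m + d)"] have "F (b + n) \<le> F (b + Suc (m + d))" using lt by simp
      also have "\<dots> < F (b + (m + d))" using g_md g_neg[of "m + d"] by simp
      also have "\<dots> \<le> F b" by (rule max)
      finally show False using cyclicD[OF cycF] by simp
    qed
  qed
  hence md: "m = n - d" "d \<le> n" by auto
  have "unimodal_from n F b j e d"
    unfolding unimodal_from_def
  proof (intro conjI allI impI)
    show "0 < j" "e \<le> 1" "d \<le> 1" using j0 by (auto simp: e_def d_def)
    show "j + e + d < n" using jem \<open>m + d = n\<close> by simp
    show "F (Suc (b + k)) < F (b + k)" if "k < j" for k using before_j[OF that] g_neg by simp
    show "F (Suc (b + j)) = F (b + j)" if "e = 1" using that g_zero by (auto simp: e_def split: if_splits)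
    show "F (b + k) < F (Suc (b + k))" if "j + e \<le> k \<and> k < n - d" for k
      using before_m[of k] that md g_pos by simp
    show "F (b + n) = F (b + (n - 1))" if "d = 1"
    proof -
      have "g m = 0" "n = Suc m" using that \<open>m + d = n\<close> by (auto simp: d_def split: if_splits)
      thus ?thesis using g_zero[of m] by simp
    qed
  qed
  thus thesis by (rule that)
qed


text \<open>Along a descent of \<open>F\<close> the increments \<open>- F\<close> of \<open>D\<close> grow, so \<open>D\<close> is convex there and its maximum
  lies at an end. Concretely, where \<open>F\<close> is still nonnegative \<open>D\<close> has only fallen since the start,
  and where \<open>F\<close> is negative \<open>D\<close> only rises up to the end.\<close>

lemma flux_negative_on_descent:
  fixes F D :: "nat \<Rightarrow> real"
  assumes flux: "\<And>i. D (Suc i) = D i - F (Suc i)"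
    and desc: "\<And>k. k < j \<Longrightarrow> F (Suc (b + k)) < F (b + k)"
    and ends: "D b < 0" "D (b + (j - 1)) < 0" and k: "k < j"
  shows "D (b + k) < 0"
proof (cases "0 \<le> F (b + k)")
  case True
  have "i \<le> k \<Longrightarrow> 0 \<le> F (b + (k - i))" for i
  proof (induction i)
    case (Suc i)
    have "F (Suc (b + (k - Suc i))) < F (b + (k - Suc i))" using desc k by simp
    moreover have "Suc (b + (k - Suc i)) = b + (k - i)" using Suc.prems by simp
    ultimately show ?case using Suc by simp
  qed (use True in simp)
  from this[of "k - _"] have nonneg: "i \<le> k \<Longrightarrow> 0 \<le> F (b + i)" for i by (metis diff_diff_cancel diff_le_self)
  have "i \<le> k \<Longrightarrow> D (b + i) < 0" for i
  proof (induction i)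
    case (Suc i)
    thus ?case using nonneg[of "Suc i"] flux[of "b + i"] by simp
  qed (use ends in simp)
  thus ?thesis by simp
next
  case False
  have neg: "i < j - k \<Longrightarrow> F (b + k + i) < 0" for i
  proof (induction i)
    case (Suc i)
    hence "F (Suc (b + (k + i))) < F (b + (k + i))" by (intro desc) simp
    thus ?case using Suc by (simp add: add.assoc)
  qed (use False in simp)
  have "i < j - k \<Longrightarrow> D (b + k) \<le> D (b + k + i)" for i
  proof (induction i)
    case (Suc i)
    thus ?case using neg[of "Suc i"] flux[of "b + k + i"] by simp
  qed simp
  from this[of "j - 1 - k"] ends k show ?thesis by (simp add: diff_less_mono2)
qed

text \<open>The signs are needed on the four edges next to peaks and valleys; convexity does the rest. With
  \<open>P\<close> and \<open>Q\<close> the fluxes after \<open>p\<close> and after \<open>q\<close>, the flux before \<open>p\<close> is \<open>P + F p\<close> and the flux before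
  \<open>q\<close> is \<open>Q + F q\<close>. For a unique peak and a unique valley the constant has to move the interval
  between the maximum of \<open>P\<close>, \<open>Q + F q\<close> and the minimum of \<open>P + F p\<close>, \<open>Q\<close> around 0, and
  balance says that this interval is not empty. A second peak forces \<open>P + c = 0\<close> and a second valley
  forces \<open>Q + c = 0\<close>.\<close>

lemma flux_with_gradient_signs:
  fixes F D0 :: "nat \<Rightarrow> real"
  assumes cycF: "cyclic n F" and uni: "unimodal_from n F b j e d"
    and cycD: "cyclic n D0" and flux: "\<And>i. D0 (Suc i) = D0 i - F (Suc i)"
    and peak: "0 < F b" and valley: "F (b + j) < 0"
    and bal: "if d = 0 \<or> e = 0
      then D0 (b + (n - d)) < D0 (b + j) \<and> D0 (b + (j + e - 1)) < D0 (b + (n - 1))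
      else D0 (b + (n - d)) = D0 (b + j)"
  obtains c where "\<And>i. sgn (D0 i + c) = sgn (F (Suc i) - F i)"
proof -
  note u = uni[unfolded unimodal_from_def]
  have per: "D0 (b + n) = D0 b" "F (b + n) = F b" using cycD cycF by (auto simp: cyclicD)
  have j: "0 < j" and n: "j + e + d < n" using u by auto
  have e: "e = 0 \<or> e = 1" and d: "d = 0 \<or> d = 1" using u by auto
  have Fp: "F (b + (n - d)) = F b" using d u per by auto
  have Fq: "F (b + (j + e)) = F (b + j)" using e u by auto
  have before_p: "D0 (b + (n - d - 1)) = D0 (b + (n - d)) + F b"
  proof -
    have "Suc (b + (n - d - 1)) = b + (n - d)" using n by simp
    thus ?thesis using flux[of "b + (n - d - 1)"] Fp by (simp only:)
  qed
  have after_p: "D0 b = D0 (b + (n - d)) - (if d = 1 then F b else 0)"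
    using flux[of "b + (n - 1)"] n d per by auto
  have before_q: "D0 (b + (j - 1)) = D0 (b + j) + F (b + j)"
    using flux[of "b + (j - 1)"] j by simp
  have after_q: "D0 (b + (j + e)) = D0 (b + j) - (if e = 1 then F (b + j) else 0)"
    using flux[of "b + j"] Fq e by auto
  define P where "P = D0 (b + (n - d))"
  define Q where "Q = D0 (b + j)"
  define c where "c = (if d = 1 then - P else if e = 1 then - Q
    else - (max P (Q + F (b + j)) + min (P + F b) Q) / 2)"
  have bal': "d = 0 \<Longrightarrow> e = 0 \<Longrightarrow> P < Q \<and> Q + F (b + j) < P + F b"
    "d = 1 \<Longrightarrow> e = 0 \<Longrightarrow> P < Q \<and> Q + F (b + j) < P"
    "d = 0 \<Longrightarrow> e = 1 \<Longrightarrow> P < Q \<and> Q < P + F b"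
    "d = 1 \<Longrightarrow> e = 1 \<Longrightarrow> P = Q"
    using bal before_p before_q n j unfolding P_def Q_def by auto
  have ends: "D0 b + c < 0" "D0 (b + (j - 1)) + c < 0"
      "0 < D0 (b + (j + e)) + c" "0 < D0 (b + (n - d - 1)) + c"
      "d = 1 \<Longrightarrow> P + c = 0" "e = 1 \<Longrightarrow> Q + c = 0"
    unfolding after_p before_q after_q before_p P_def[symmetric] Q_def[symmetric] c_def
    using bal' e d peak valley by (auto simp: max_def min_def field_simps)
  have fluxc: "D0 (Suc i) + c = (D0 i + c) - F (Suc i)" for i using flux[of i] by simp
  have down: "D0 (b + k) + c < 0" if "k < j" for k
    by (rule flux_negative_on_descent[of "\<lambda>i. D0 i + c" F j b]) (use fluxc ends u that in auto)
  have up: "0 < D0 (b + k) + c" if "j + e \<le> k" "k < n - d" for k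
  proof -
    have "- (D0 ((b + (j + e)) + (k - (j + e))) + c) < 0"
    proof (rule flux_negative_on_descent[of "\<lambda>i. - (D0 i + c)" "\<lambda>i. - F i" "n - d - (j + e)"])
      show "- F (Suc (b + (j + e) + l)) < - F (b + (j + e) + l)" if "l < n - d - (j + e)" for l
      proof -
        have "F (b + (j + e + l)) < F (Suc (b + (j + e + l)))" using u that by simp
        thus ?thesis by (simp add: add.assoc)
      qed
      show "- (D0 (b + (j + e) + (n - d - (j + e) - 1)) + c) < 0"
        using ends(4) n by (simp add: add.assoc)
    qed (use fluxc ends that in auto)
    thus ?thesis using that by simp
  qed
  have window: "sgn (D0 (b + k) + c) = sgn (F (Suc (b + k)) - F (b + k))" if k: "k < n" for k
  proof -
    consider "k < j" | "e = 1" "k = j" | "j + e \<le> k" "k < n - d" | "d = 1" "k = n - 1"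
      using k e d by force
    thus ?thesis
    proof cases
      case 1
      thus ?thesis using down[of k] u by simp
    next
      case 2
      thus ?thesis using ends(6) u unfolding Q_def by simp
    next
      case 3
      thus ?thesis using up[of k] u by simp
    next
      case 4
      thus ?thesis using ends(5) u n unfolding P_def by simp
    qed
  qed
  have "sgn (D0 i + c) = sgn (F (Suc i) - F i)" for i
  proof -
    obtain k where k: "k < n" "i mod n = (b + k) mod n"
      using window_representative[of n i b] n by auto
    have "cyclic n (\<lambda>i. sgn (D0 i + c) - sgn (F (Suc i) - F i))"
      using cyclicD[OF cycF] cyclicD[OF cycF, of "Suc _"] cyclicD[OF cycD] by (intro cyclicI) simp
    from cyclic_cong[OF this k(2)] window[OF k(1)] show ?thesis by simp
  qed
  thus thesis by (rule that)
qed

lemma unimodal_bounds: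
  assumes "unimodal_from n F b j e d"
  shows "0 < j" "e = 0 \<or> e = 1" "d = 0 \<or> d = 1" "j + e + d < n"
  using assms unfolding unimodal_from_def by auto

lemma unimodal_decreasing:
  assumes "unimodal_from n F b j e d" "k < l" "l \<le> j"
  shows "F (b + l) < F (b + k)"
proof -
  have "- F (b + k) < - F (b + l)"
    by (rule increasing_on_interval[of k l "\<lambda>i. - F (b + i)"]) (use assms in \<open>auto simp: unimodal_from_def\<close>)
  thus ?thesis by simp
qed

lemma unimodal_increasing:
  assumes "unimodal_from n F b j e d" "j + e \<le> k" "k < l" "l \<le> n - d"
  shows "F (b + k) < F (b + l)"
  by (rule increasing_on_interval[of k l "\<lambda>i. F (b + i)"]) (use assms in \<open>auto simp: unimodal_from_def\<close>)

lemma unimodal_plateaus: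
  assumes "cyclic n F" "unimodal_from n F b j e d"
  shows "F (b + (j + e)) = F (b + j)" "F (b + (n - d)) = F b"
  using assms by (auto simp: unimodal_from_def le_Suc_eq cyclicD)

text \<open>Reflection exchanges peaks with valleys. Statements about valleys and negative vertices are
  obtained from those about peaks and positive vertices in this way.\<close>

lemma unimodal_uminus:
  assumes cycF: "cyclic n F" and uni: "unimodal_from n F b j e d"
  shows "unimodal_from n (\<lambda>i. - F i) (b + (j + e)) (n - d - (j + e)) d e"
  unfolding unimodal_from_def
proof (intro conjI allI impI)
  note u = uni[unfolded unimodal_from_def]
  have per: "F (i + n) = F i" for i using cycF by (rule cyclicD)
  show "0 < n - d - (j + e)" "d \<le> 1" "e \<le> 1" "n - d - (j + e) + d + e < n" using u by auto
  show "- F (Suc (b + (j + e) + k)) < - F (b + (j + e) + k)" if "k < n - d - (j + e)" for k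
  proof -
    have "F (b + (j + e + k)) < F (Suc (b + (j + e + k)))" using u that by simp
    thus ?thesis by (simp add: add.assoc)
  qed
  show "- F (Suc (b + (j + e) + (n - d - (j + e)))) = - F (b + (j + e) + (n - d - (j + e)))" if "d = 1"
  proof -
    have "b + (j + e) + (n - d - (j + e)) = b + (n - 1)" "Suc (b + (n - 1)) = b + n" using u that by auto
    thus ?thesis using u that by simp
  qed
  show "- F (b + (j + e) + k) < - F (Suc (b + (j + e) + k))" if k: "n - d - (j + e) + d \<le> k \<and> k < n - e" for k
  proof -
    define l where "l = j + e + k - n"
    have "n \<le> j + e + k" using k u by linarith
    hence l: "j + e + k = n + l" unfolding l_def by simp
    have "l < j" using l k u by linarith
    hence "F (Suc (b + l)) < F (b + l)" using u by simp
    moreover have "b + (j + e) + k = b + l + n" using l by simp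
    ultimately show ?thesis using per[of "b + l"] per[of "Suc (b + l)"] by (simp only: add_Suc)
  qed
  show "- F (b + (j + e) + n) = - F (b + (j + e) + (n - 1))" if "e = 1"
  proof -
    have "b + (j + e) + (n - 1) = b + j + n" "b + (j + e) + n = Suc (b + j) + n" using u that by auto
    thus ?thesis using u that per[of "b + j"] per[of "Suc (b + j)"] by (simp only:)
  qed
qed

lemma unimodal_max:
  fixes F :: "nat \<Rightarrow> real"
  assumes cycF: "cyclic n F" and uni: "unimodal_from n F b j e d" and k: "k < n"
  shows "F (b + k) \<le> F b" and "F (b + k) = F b \<longleftrightarrow> k = 0 \<or> k = n - d"
proof -
  note ud = unimodal_bounds[OF uni]
  have dec: "F (b + k) < F b" if "0 < k" "k \<le> j"
    using unimodal_decreasing[OF uni, of 0 k] that by simp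
  have inc: "F (b + k) < F b" if "j + e \<le> k" "k < n - d"
    using unimodal_increasing[OF uni, of k "n - d"] unimodal_plateaus[OF cycF uni] that by simp
  consider "k = 0" | "0 < k" "k \<le> j" | "j + e \<le> k" "k < n - d" | "k = n - d" using ud k by force
  hence "F (b + k) \<le> F b \<and> (F (b + k) = F b \<longleftrightarrow> k = 0 \<or> k = n - d)"
  proof cases
    case 2
    thus ?thesis using dec ud by auto
  next
    case 3
    thus ?thesis using inc ud by auto
  qed (use unimodal_plateaus[OF cycF uni] in auto)
  thus "F (b + k) \<le> F b" and "F (b + k) = F b \<longleftrightarrow> k = 0 \<or> k = n - d" by auto
qed

lemma unimodal_maximizers:
  fixes F :: "nat \<Rightarrow> real"
  assumes cycF: "cyclic n F" and uni: "unimodal_from n F b j e d"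
  shows "{i. i < n \<and> (\<forall>k<n. F k \<le> F i)} = {(b + (n - d)) mod n, b mod n}"
proof -
  note ud = unimodal_bounds[OF uni]
  have n: "0 < n" using ud by simp
  have le: "F i \<le> F b" for i
  proof -
    obtain k where k: "k < n" "i mod n = (b + k) mod n" using window_representative[OF n] .
    thus ?thesis using cyclic_cong[OF cycF k(2)] unimodal_max(1)[OF cycF uni k(1)] by simp
  qed
  have "(\<forall>k<n. F k \<le> F i) \<longleftrightarrow> F i = F b" for i
  proof
    assume "\<forall>k<n. F k \<le> F i"
    hence "F (b mod n) \<le> F i" using n by simp
    thus "F i = F b" using cyclic_mod[OF cycF] le[of i] by simp
  qed (use le in simp)
  moreover have "i < n \<and> F i = F b \<longleftrightarrow> i = (b + (n - d)) mod n \<or> i = b mod n" for i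
  proof
    assume i: "i < n \<and> F i = F b"
    obtain k where k: "k < n" "i mod n = (b + k) mod n" using window_representative[OF n] .
    have "k = 0 \<or> k = n - d"
      using unimodal_max(2)[OF cycF uni k(1)] cyclic_cong[OF cycF k(2)] i by simp
    thus "i = (b + (n - d)) mod n \<or> i = b mod n" using k i by auto
  next
    assume "i = (b + (n - d)) mod n \<or> i = b mod n"
    thus "i < n \<and> F i = F b"
      using n cyclic_mod[OF cycF] unimodal_plateaus(2)[OF cycF uni] by auto
  qed
  ultimately show ?thesis by blast
qed

text \<open>If the maximum were not positive, a zero sum would force all values to vanish.\<close>

lemma unimodal_peak_pos:
  fixes F :: "nat \<Rightarrow> real"
  assumes cycF: "cyclic n F" and uni: "unimodal_from n F b j e d" and sum0: "(\<Sum>i<n. F i) = 0"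
  shows "0 < F b"
proof (rule ccontr)
  assume "\<not> 0 < F b"
  hence le: "F (b + k) \<le> 0" if "k < n" for k using unimodal_max(1)[OF cycF uni that] by simp
  have "(\<Sum>k<n. F (b + k)) = 0" using sum_cyclic_shift[OF cycF] sum0 by simp
  hence z: "F (b + k) = 0" if "k < n" for k
    using sum_nonneg_eq_0_iff[of "{..<n}" "\<lambda>k. - F (b + k)"] le that by (simp add: sum_negf)
  show False using unimodal_decreasing[OF uni, of 0 1] z[of 0] z[of 1] unimodal_bounds[OF uni] by simp
qed

lemma unimodal_valley_neg:
  fixes F :: "nat \<Rightarrow> real"
  assumes cycF: "cyclic n F" and uni: "unimodal_from n F b j e d" and sum0: "(\<Sum>i<n. F i) = 0"
  shows "F (b + j) < 0"
  using unimodal_peak_pos[OF _ unimodal_uminus[OF cycF uni]] sum0 unimodal_plateaus(1)[OF cycF uni]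
  by (simp add: cyclic_def cyclicD[OF cycF] sum_negf)

text \<open>Here \<open>s\<close> is the first nonpositive index and \<open>t\<close> the first positive index after the valley. By strict
  monotonicity a zero can only be the first nonpositive or the last nonpositive value.\<close>

lemma unimodal_signs:
  fixes F :: "nat \<Rightarrow> real"
  assumes cycF: "cyclic n F" and uni: "unimodal_from n F b j e d"
    and peak: "0 < F b" and valley: "F (b + j) < 0"
  obtains s t where "0 < s" "s \<le> j" "j + e < t" "t \<le> n - d"
    "\<forall>k<s. 0 < F (b + k)" "\<forall>k. s \<le> k \<and> k < t \<longrightarrow> F (b + k) \<le> 0"
    "\<forall>k. t \<le> k \<and> k \<le> n \<longrightarrow> 0 < F (b + k)"
    "\<forall>k<n. F (b + k) = 0 \<longrightarrow> k = s \<or> k = t - 1"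
proof -
  note ud = unimodal_bounds[OF uni] and pl = unimodal_plateaus[OF cycF uni]
  define s where "s = (LEAST k. F (b + k) \<le> 0)"
  define t where "t = (LEAST k. j + e \<le> k \<and> 0 < F (b + k))"
  have s: "F (b + s) \<le> 0" "s \<le> j"
    unfolding s_def by (rule LeastI[of _ j], use valley in simp) (rule Least_le, use valley in simp)
  have before_s: "0 < F (b + k)" if "k < s" for k
    using not_less_Least[of k "\<lambda>k. F (b + k) \<le> 0"] that unfolding s_def by force
  have s0: "0 < s" using s peak by (cases s) auto
  have ex: "j + e \<le> n - d \<and> 0 < F (b + (n - d))" using ud pl peak by auto
  have t: "j + e \<le> t" "0 < F (b + t)"
    using LeastI[of "\<lambda>k. j + e \<le> k \<and> 0 < F (b + k)", OF ex] unfolding t_def by auto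
  have tn: "t \<le> n - d" unfolding t_def using ex by (rule Least_le)
  have jet: "j + e < t" using t pl(1) valley by (cases "j + e = t") auto
  have before_t: "F (b + k) \<le> 0" if "j + e \<le> k" "k < t" for k
    using not_less_Least[of k "\<lambda>k. j + e \<le> k \<and> 0 < F (b + k)"] that unfolding t_def by force
  have neg1: "F (b + k) < 0" if "s < k" "k \<le> j" for k
    using unimodal_decreasing[OF uni, of s k] that s by simp
  have neg2: "F (b + k) < 0" if "j + e \<le> k" "k < t - 1" for k
    using unimodal_increasing[OF uni, of k "t - 1"] before_t[of "t - 1"] that jet tn by force
  have mid: "F (b + k) \<le> 0" if "s \<le> k" "k < t" for k
    using neg1[of k] s before_t[of k] that ud by (cases "k = s"; cases "k \<le> j") force+
  have last: "0 < F (b + k)" if tk: "t \<le> k" "k \<le> n" for k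
  proof -
    consider "k = t" | "t < k" "k \<le> n - d" | "k = n" using tk ud by force
    thus ?thesis
    proof cases
      case 2
      thus ?thesis using unimodal_increasing[OF uni, of t k] t by simp
    qed (use t peak cyclicD[OF cycF, of b] in auto)
  qed
  have zero: "k = s \<or> k = t - 1" if "k < n" "F (b + k) = 0" for k
  proof -
    have "s \<le> k" "k < t" using before_s[of k] last[of k] that by force+
    thus ?thesis using neg1[of k] neg2[of k] that ud by force
  qed
  show thesis by (rule that[of s t]) (use s0 s jet tn before_s mid last zero in auto)
qed

text \<open>The two linear conditions say that the quotient \<open>h = y / F\<close> does not jump across the two edges \<open>t1\<close>
  and \<open>t2\<close> where \<open>F\<close> changes sign; if one end of such an edge is a zero of \<open>F\<close>, they say that \<open>y\<close>
  vanishes there as well. All other edges join values of the same sign, so the ground state identity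
  has only nonnegative terms.\<close>

lemma unimodal_energy_bound:
  fixes F w :: "nat \<Rightarrow> real"
  assumes cycF: "cyclic n F" and uni: "unimodal_from n F b j e d"
    and peak: "0 < F b" and valley: "F (b + j) < 0"
    and cycw: "cyclic n w" and pos: "\<And>i. 0 < w i" and eig: "cycle_eigenfunction w c F"
  obtains t1 t2 where "\<forall>y. cyclic n y \<longrightarrow> y t1 * F (Suc t1) = y (Suc t1) * F t1 \<longrightarrow>
     y t2 * F (Suc t2) = y (Suc t2) * F t2 \<longrightarrow>
     c * (\<Sum>i<n. (y i)\<^sup>2) \<le> (\<Sum>i<n. w i * (y (Suc i) - y i)\<^sup>2)"
proof -
  note ud = unimodal_bounds[OF uni]
  obtain s t where st: "0 < s" "s \<le> j" "j + e < t" "t \<le> n - d"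
    and s_pos: "\<forall>k<s. 0 < F (b + k)" and st_neg: "\<forall>k. s \<le> k \<and> k < t \<longrightarrow> F (b + k) \<le> 0"
    and t_pos: "\<forall>k. t \<le> k \<and> k \<le> n \<longrightarrow> 0 < F (b + k)"
    and zero: "\<forall>k<n. F (b + k) = 0 \<longrightarrow> k = s \<or> k = t - 1"
    using unimodal_signs[OF cycF uni peak valley] .
  define t1 where "t1 = b + (s - 1)"
  define t2 where "t2 = b + (t - 1)"
  have t1: "Suc t1 = b + s" and t2: "Suc t2 = b + t" using st by (auto simp: t1_def t2_def)
  have F1: "0 < F t1" and F2: "0 < F (Suc t2)"
    using s_pos[rule_format, of "s - 1"] t_pos[rule_format, of t] st unfolding t2 by (auto simp: t1_def)
  show thesis
  proof (rule that[of t1 t2], intro allI impI)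
    fix y assume cycy: "cyclic n y" and y1: "y t1 * F (Suc t1) = y (Suc t1) * F t1"
      and y2: "y t2 * F (Suc t2) = y (Suc t2) * F t2"
    define h where "h i = y i / F i" for i
    have cych: "cyclic n h" unfolding h_def using cycF cycy by (simp add: cyclic_def)
    have hF: "h i * F i = y i" for i
    proof (cases "F i = 0")
      case True
      obtain k where k: "k < n" "i mod n = (b + k) mod n"
        using window_representative[of n i b] ud by auto
      have "F (b + k) = 0" using cyclic_cong[OF cycF k(2)] True by simp
      with zero[rule_format, OF k(1)] consider "F (Suc t1) = 0" "y i = y (Suc t1)" | "F t2 = 0" "y i = y t2"
        using cyclic_cong[OF cycy k(2)] unfolding t1 t2_def by auto
      hence "y i = 0" using y1 y2 F1 F2 by cases auto
      thus ?thesis using True by simp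
    qed (simp add: h_def)
    let ?T = "\<lambda>i. w i * (F i * F (Suc i)) * (h i - h (Suc i))\<^sup>2"
    have T: "0 \<le> ?T (b + k)" if "k < n" for k
    proof -
      have "0 \<le> F (b + k) * F (Suc (b + k)) \<or> h (b + k) = h (Suc (b + k))"
      proof -
        consider "Suc k < s" | "k = s - 1" | "s \<le> k" "Suc k < t" | "k = t - 1" | "t \<le> k"
          by linarith
        thus ?thesis
        proof cases
          case 1
          thus ?thesis using s_pos[rule_format, of k] s_pos[rule_format, of "Suc k"] by simp
        next
          case 2
          hence k: "b + k = t1" by (simp add: t1_def)
          show ?thesis using F1 y1 unfolding h_def k
            by (cases "F (Suc t1) = 0") (auto simp: field_simps)
        next
          case 3
          thus ?thesis using st_neg[rule_format, of k] st_neg[rule_format, of "Suc k"] by (simp add: mult_nonpos_nonpos)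
        next
          case 4
          hence k: "b + k = t2" by (simp add: t2_def)
          show ?thesis using F2 y2 unfolding h_def k
            by (cases "F t2 = 0") (auto simp: field_simps)
        next
          case 5
          thus ?thesis using t_pos[rule_format, of k] t_pos[rule_format, of "Suc k"] that by simp
        qed
      qed
      thus ?thesis using pos[of "b + k"] by auto
    qed
    have cycT: "cyclic n ?T"
      using cyclicD[OF cych, of "Suc _"] cyclicD[OF cycF, of "Suc _"]
      by (intro cyclicI) (simp add: cyclicD[OF cych] cyclicD[OF cycF] cyclicD[OF cycw])
    have "0 \<le> (\<Sum>k<n. ?T (b + k))" using T by (intro sum_nonneg) auto
    also have "\<dots> = (\<Sum>i<n. ?T i)" by (rule sum_cyclic_shift[OF cycT])
    also have "\<dots> = (\<Sum>i<n. w i * (y (Suc i) - y i)\<^sup>2) - c * (\<Sum>i<n. (y i)\<^sup>2)"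
      unfolding ground_state_identity[OF cycF cycw cych eig, symmetric] hF ..
    finally show "c * (\<Sum>i<n. (y i)\<^sup>2) \<le> (\<Sum>i<n. w i * (y (Suc i) - y i)\<^sup>2)" by simp
  qed
qed

section \<open>Arcs of the cycle and periodic vectors\<close>

definition unroll :: "nat \<Rightarrow> real vec \<Rightarrow> nat \<Rightarrow> real" where
  "unroll n x i = x $ (i mod n)"

lemma cyclic_unroll: "cyclic n (unroll n x)"
  by (simp add: cyclic_def unroll_def)

lemma unroll_less [simp]: "i < n \<Longrightarrow> unroll n x i = x $ i"
  by (simp add: unroll_def)

lemma cycle_edge_iff:
  assumes "u < n" "v < n"
  shows "{u, v} \<in> cycle_edges n \<longleftrightarrow> v = Suc u mod n \<or> u = Suc v mod n"
  using assms unfolding cycle_edges_def by (auto simp: doubleton_eq_iff)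

lemma Suc_mod_inj:
  assumes "Suc u mod n = Suc v mod n" "u < n" "v < n"
  shows "u = v"
  using window_unique[of 1 u n v] assms by simp

lemma Suc_mod_neq:
  assumes "2 \<le> n" "i < n"
  shows "Suc i mod n \<noteq> i"
  using assms by (cases "Suc i = n") auto

lemma Suc_Suc_mod_neq:
  assumes "3 \<le> n" "i < n"
  shows "Suc (Suc i mod n) mod n \<noteq> i"
  using assms by (cases "Suc i = n"; cases "Suc (Suc i) = n") auto

definition arc :: "nat \<Rightarrow> nat \<Rightarrow> nat \<Rightarrow> nat list" where
  "arc n a l = map (\<lambda>k. (a + k) mod n) [0..<l]"

lemma forward_walk_arc:
  assumes vs: "vs \<noteq> []" "set vs \<subseteq> {..<n}"
    and fwd: "\<And>k. Suc k < length vs \<Longrightarrow> vs ! Suc k = Suc (vs ! k) mod n"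
  shows "vs = arc n (hd vs) (length vs)"
proof (rule nth_equalityI)
  fix k assume "k < length vs"
  hence "vs ! k = (hd vs + k) mod n"
  proof (induction k)
    case 0
    thus ?case using vs by (simp add: hd_conv_nth subset_iff)
  next
    case (Suc k)
    thus ?case using fwd[of k] by (simp add: mod_Suc_eq)
  qed
  thus "vs ! k = arc n (hd vs) (length vs) ! k" using \<open>k < length vs\<close> by (simp add: arc_def)
qed (simp add: arc_def)

text \<open>Consecutive vertices of an induced path are neighbours on the cycle, and the path cannot turn back
  because its vertices are distinct. So it runs along the cycle in one of the two directions.\<close>

lemma cycle_path_order_arc:
  assumes po: "path_order S (induced_edges (cycle_edges n) S) vs" and S: "S \<subseteq> {..<n}"
  shows "\<exists>a. vs = arc n a (length vs) \<or> rev vs = arc n a (length vs)"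
proof -
  from po have ne: "vs \<noteq> []" and dist: "distinct vs" and set: "set vs = S"
    and E: "induced_edges (cycle_edges n) S = {{vs ! i, vs ! Suc i} |i. Suc i < length vs}"
    unfolding path_order_def by auto
  have lt: "vs ! k < n" if "k < length vs" for k using set S that nth_mem by blast
  have adj: "vs ! Suc k = Suc (vs ! k) mod n \<or> vs ! k = Suc (vs ! Suc k) mod n" if k: "Suc k < length vs" for k
  proof -
    have "{vs ! k, vs ! Suc k} \<in> induced_edges (cycle_edges n) S" unfolding E using k by blast
    hence "{vs ! k, vs ! Suc k} \<in> cycle_edges n" by (simp add: induced_edges_def)
    thus ?thesis using lt k by (simp add: cycle_edge_iff)
  qed
  have neq: "vs ! k \<noteq> vs ! Suc (Suc k)" if "Suc (Suc k) < length vs" for k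
    using dist that by (simp add: nth_eq_iff_index_eq)
  show ?thesis
  proof (cases "length vs = 1 \<or> vs ! 1 = Suc (vs ! 0) mod n")
    case True
    have "vs ! Suc k = Suc (vs ! k) mod n" if "Suc k < length vs" for k
      using that
    proof (induction k)
      case (Suc k)
      hence "vs ! Suc k = Suc (vs ! k) mod n" by simp
      with adj[OF Suc.prems] neq[OF Suc.prems] Suc_mod_inj[of "vs ! k" n "vs ! Suc (Suc k)"] lt Suc.prems
      show ?case by auto
    qed (use True in auto)
    thus ?thesis using forward_walk_arc[OF ne, of n] set S by auto
  next
    case False
    hence len: "1 < length vs" using ne by (cases vs) auto
    have bwd: "vs ! k = Suc (vs ! Suc k) mod n" if "Suc k < length vs" for k
      using that
    proof (induction k)
      case 0
      thus ?case using adj[of 0] False by auto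
    next
      case (Suc k)
      hence "vs ! k = Suc (vs ! Suc k) mod n" by simp
      with adj[OF Suc.prems] neq[OF Suc.prems] show ?case by auto
    qed
    have "rev vs ! Suc k = Suc (rev vs ! k) mod n" if k: "Suc k < length vs" for k
    proof -
      have "Suc (length vs - Suc (Suc k)) = length vs - Suc k" using k by simp
      thus ?thesis using bwd[of "length vs - Suc (Suc k)"] k by (simp add: rev_nth)
    qed
    hence "rev vs = arc n (hd (rev vs)) (length vs)"
      using forward_walk_arc[of "rev vs" n] ne set S by simp
    thus ?thesis by blast
  qed
qed

lemma arc_path_order:
  assumes l: "0 < l" "l < n"
  shows "path_order (set (arc n a l)) (induced_edges (cycle_edges n) (set (arc n a l))) (arc n a l)"
  unfolding path_order_def
proof (intro conjI)
  show "arc n a l \<noteq> []" using l by (simp add: arc_def)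
  show "distinct (arc n a l)"
    unfolding arc_def distinct_map using l by (auto intro!: inj_onI dest: window_unique)
  have step: "Suc ((a + k) mod n) mod n = (a + Suc k) mod n" for k by (simp add: mod_Suc_eq)
  show "induced_edges (cycle_edges n) (set (arc n a l)) = {{arc n a l ! i, arc n a l ! Suc i} |i. Suc i < length (arc n a l)}"
    (is "?L = ?R")
  proof
    show "?L \<subseteq> ?R"
    proof
      fix E assume "E \<in> ?L"
      then obtain i where E: "E = {i, Suc i mod n}" and i: "i \<in> set (arc n a l)" "Suc i mod n \<in> set (arc n a l)"
        unfolding induced_edges_def cycle_edges_def by auto
      from i obtain k k' where k: "k < l" "i = (a + k) mod n" and k': "k' < l" "Suc i mod n = (a + k') mod n"
        unfolding arc_def by auto
      have "k' = Suc k" using window_unique[of a "Suc k" n k'] k k' l step[of k] by simp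
      thus "E \<in> ?R" using k k' E by (auto simp: arc_def intro!: exI[of _ k])
    qed
    show "?R \<subseteq> ?L"
    proof
      fix E assume "E \<in> ?R"
      then obtain k where k: "Suc k < l" "E = {(a + k) mod n, (a + Suc k) mod n}"
        by (auto simp: arc_def)
      have "E \<in> cycle_edges n" unfolding cycle_edges_def k(2) step[symmetric]
        using l by (intro CollectI exI[of _ "(a + k) mod n"]) auto
      moreover have "E \<subseteq> set (arc n a l)" using k unfolding arc_def by force
      ultimately show "E \<in> ?L" by (simp add: induced_edges_def)
    qed
  qed
qed simp

text \<open>The shape expressed by comparisons of neighbouring entries: \<open>u\<close> is the position of the first
  maximum and \<open>r\<close> the number of maxima.\<close>

lemma up_down_iff:
  "up_down ys \<longleftrightarrow> (\<exists>u r. r \<in> {1, 2} \<and> u + r \<le> length ys \<and> (\<forall>k<u. ys ! k < ys ! Suc k) \<and>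
     (r = 2 \<longrightarrow> ys ! Suc u = ys ! u) \<and> (\<forall>k. u + r \<le> Suc k \<and> Suc k < length ys \<longrightarrow> ys ! Suc k < ys ! k))"
  (is "_ \<longleftrightarrow> ?R")
proof
  assume "up_down ys"
  then obtain us m r ds where ys: "ys = us @ replicate r m @ ds" and r: "r = 1 \<or> r = 2"
    and inc: "sorted_wrt (<) (us @ [m])" and dec: "sorted_wrt (>) (m # ds)"
    unfolding up_down_def by auto
  show ?R
  proof (rule exI[of _ "length us"], rule exI[of _ r], intro conjI allI impI)
    show "r \<in> {1, 2}" "length us + r \<le> length ys" using r ys by auto
    have A: "ys ! k = (us @ [m]) ! k" if "k \<le> length us" for k
      using that r unfolding ys by (auto simp: nth_append)
    show "ys ! k < ys ! Suc k" if "k < length us" for k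
      using sorted_wrt_nth_less[OF inc, of k "Suc k"] that A[of k] A[of "Suc k"] by simp
    show "ys ! Suc (length us) = ys ! length us" if "r = 2"
      using that unfolding ys by (simp add: nth_append numeral_2_eq_2)
    have B: "ys ! (length us + r - 1 + k) = (m # ds) ! k" if "k \<le> length ds" for k
      using that r unfolding ys by (auto simp: nth_append nth_Cons' numeral_2_eq_2)
    show "ys ! Suc k < ys ! k" if k: "length us + r \<le> Suc k \<and> Suc k < length ys" for k
    proof -
      define i where "i = Suc k - (length us + r)"
      have i: "length us + r - 1 + i = k" "length us + r - 1 + Suc i = Suc k" "Suc i \<le> length ds"
        using k r unfolding i_def ys by auto
      show ?thesis
        using sorted_wrt_nth_less[OF dec, of i "Suc i"] B[of i] B[of "Suc i"] i by simp
    qed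
  qed
next
  assume ?R
  then obtain u r where r: "r = 1 \<or> r = 2" and ur: "u + r \<le> length ys"
    and inc: "\<And>k. k < u \<Longrightarrow> ys ! k < ys ! Suc k" and eq: "r = 2 \<longrightarrow> ys ! Suc u = ys ! u"
    and dec: "\<And>k. u + r \<le> Suc k \<Longrightarrow> Suc k < length ys \<Longrightarrow> ys ! Suc k < ys ! k" by blast
  have last: "ys ! (u + r - 1) = ys ! u" using r eq by auto
  show "up_down ys"
    unfolding up_down_def
  proof (intro exI conjI)
    show "ys = take u ys @ replicate r (ys ! u) @ drop (u + r) ys"
      using r
    proof
      assume "r = 1"
      thus ?thesis using ur id_take_nth_drop[of u ys] by simp
    next
      assume "r = 2"
      thus ?thesis using ur eq id_take_nth_drop[of u ys] Cons_nth_drop_Suc[of "Suc u" ys]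
        by (simp add: numeral_2_eq_2)
    qed
    show "r \<in> {1, 2}" using r by auto
    have "u < length ys" using ur r by auto
    hence "take u ys @ [ys ! u] = take (Suc u) ys" by (simp add: take_Suc_conv_app_nth)
    thus "sorted_wrt (<) (take u ys @ [ys ! u])"
      using inc ur by (auto simp: sorted_wrt_iff_nth_Suc_transp)
    have "ys ! u # drop (u + r) ys = drop (u + r - 1) ys"
      using Cons_nth_drop_Suc[of "u + r - 1" ys] ur r last by auto
    thus "sorted_wrt (>) (ys ! u # drop (u + r) ys)"
      using dec ur r by (auto simp: sorted_wrt_iff_nth_Suc_transp transp_def)
  qed
qed

lemma up_down_rev: "up_down (rev ys) \<longleftrightarrow> up_down ys"
proof -
  have *: "up_down (rev ys)" if "up_down ys" for ys :: "real list"
  proof -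
    from that obtain us m r ds where *: "ys = us @ replicate r m @ ds" "r \<in> {1, 2}"
      "sorted_wrt (<) (us @ [m])" "sorted_wrt (>) (m # ds)" unfolding up_down_def by blast
    have "rev ys = rev ds @ replicate r m @ rev us" using * by simp
    moreover have "sorted_wrt (<) (rev ds @ [m])" "sorted_wrt (>) (m # rev us)"
      using *(3,4) by (simp_all add: sorted_wrt_append sorted_wrt_rev)
    ultimately show ?thesis using *(2) unfolding up_down_def by blast
  qed
  show ?thesis using *[of ys] *[of "rev ys"] by auto
qed

lemma down_up_iff_up_down_uminus: "down_up ys \<longleftrightarrow> up_down (map uminus ys)"
proof
  assume "down_up ys"
  then obtain us m r ds where *: "ys = us @ replicate r m @ ds" "r \<in> {1, 2}"
      "sorted_wrt (>) (us @ [m])" "sorted_wrt (<) (m # ds)" unfolding down_up_def by blast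
  thus "up_down (map uminus ys)" unfolding up_down_def
    by (intro exI[of _ "map uminus us"] exI[of _ "- m"] exI[of _ r] exI[of _ "map uminus ds"])
      (simp add: sorted_wrt_append sorted_wrt_map)
next
  assume "up_down (map uminus ys)"
  then obtain us m r ds where *: "map uminus ys = us @ replicate r m @ ds" "r \<in> {1, 2}"
      "sorted_wrt (<) (us @ [m])" "sorted_wrt (>) (m # ds)" unfolding up_down_def by blast
  have "ys = map uminus (map uminus ys)" by (simp add: o_def)
  also have "\<dots> = map uminus us @ replicate r (- m) @ map uminus ds" using *(1) by simp
  finally show "down_up ys" unfolding down_up_def using *(2-4)
    by (intro exI[of _ "map uminus us"] exI[of _ "- m"] exI[of _ r] exI[of _ "map uminus ds"])
      (simp add: sorted_wrt_append sorted_wrt_map)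
qed

text \<open>Counted from \<open>b\<close>, the positive vertices are those from \<open>t\<close> up to the last peak at \<open>n\<close> and then on
  to \<open>n + s - 1\<close>, in the notation of \<open>unimodal_signs\<close>.\<close>

lemma unimodal_positive_arc:
  fixes F :: "nat \<Rightarrow> real"
  assumes cycF: "cyclic n F" and uni: "unimodal_from n F b j e d"
    and peak: "0 < F b" and valley: "F (b + j) < 0"
  obtains a l where "0 < l" "l < n" "{i. i < n \<and> 0 < F i} = set (arc n a l)" "up_down (map F (arc n a l))"
proof -
  note ud = unimodal_bounds[OF uni]
  obtain s t where st: "0 < s" "s \<le> j" "j + e < t" "t \<le> n - d"
    and s_pos: "\<forall>k<s. 0 < F (b + k)" and st_neg: "\<forall>k. s \<le> k \<and> k < t \<longrightarrow> F (b + k) \<le> 0"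
    and t_pos: "\<forall>k. t \<le> k \<and> k \<le> n \<longrightarrow> 0 < F (b + k)"
    and zero: "\<forall>k<n. F (b + k) = 0 \<longrightarrow> k = s \<or> k = t - 1"
    using unimodal_signs[OF cycF uni peak valley] .
  define a where "a = b + t"
  define l where "l = n + s - t"
  have l: "0 < l" "l < n" using st ud unfolding l_def by auto
  have wrap: "F (a + m) = F (b + (t + m - n))" if "n \<le> t + m" for m
  proof -
    have "a + m = b + (t + m - n) + n" using that unfolding a_def by simp
    thus ?thesis using cyclicD[OF cycF] by simp
  qed
  have pos: "0 < F (a + m)" if "m < l" for m
  proof (cases "t + m \<le> n")
    case True
    thus ?thesis using t_pos[rule_format, of "t + m"] unfolding a_def by (simp add: add.assoc)
  next
    case False
    hence "t + m - n < s" "n \<le> t + m" using that unfolding l_def by auto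
    thus ?thesis using s_pos wrap[of m] by (simp only:)
  qed
  have "{i. i < n \<and> 0 < F i} = set (arc n a l)"
  proof (intro equalityI subsetI)
    fix i assume "i \<in> {i. i < n \<and> 0 < F i}"
    hence i: "i < n" "0 < F i" by auto
    obtain k where k: "k < n" "i mod n = (b + k) mod n"
      using window_representative[of n i b] i by auto
    have "0 < F (b + k)" using cyclic_cong[OF cycF k(2)] i by simp
    hence "k < s \<or> t \<le> k" using st_neg[rule_format, of k] by linarith
    thus "i \<in> set (arc n a l)"
    proof
      assume "k < s"
      hence "a + (n + k - t) = b + k + n" "n + k - t < l" using st unfolding a_def l_def by auto
      thus ?thesis using k i unfolding arc_def by (auto intro!: image_eqI[of _ _ "n + k - t"])
    next
      assume "t \<le> k"
      hence "a + (k - t) = b + k" "k - t < l" using st k unfolding a_def l_def by auto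
      thus ?thesis using k i unfolding arc_def by (auto intro!: image_eqI[of _ _ "k - t"])
    qed
  next
    fix i assume "i \<in> set (arc n a l)"
    then obtain m where m: "m < l" "i = (a + m) mod n" unfolding arc_def by auto
    thus "i \<in> {i. i < n \<and> 0 < F i}" using pos[of m] l cyclic_mod[OF cycF] by simp
  qed
  moreover have "up_down (map F (arc n a l))"
    unfolding up_down_iff
  proof (rule exI[of _ "n - d - t"], rule exI[of _ "Suc d"], intro conjI allI impI)
    have nth: "map F (arc n a l) ! k = F (a + k)" if "k < l" for k
      using that by (simp add: arc_def cyclic_mod[OF cycF])
    have len: "length (map F (arc n a l)) = l" by (simp add: arc_def)
    show "Suc d \<in> {1, 2}" using ud by auto
    show "n - d - t + Suc d \<le> length (map F (arc n a l))"
      unfolding len unfolding l_def using st ud by auto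
    show "map F (arc n a l) ! k < map F (arc n a l) ! Suc k" if k: "k < n - d - t" for k
      using nth[of k] nth[of "Suc k"] k st ud unimodal_increasing[OF uni, of "t + k" "Suc (t + k)"]
      unfolding l_def a_def by (simp add: add.assoc)
    show "map F (arc n a l) ! Suc (n - d - t) = map F (arc n a l) ! (n - d - t)" if "Suc d = 2"
    proof -
      have a: "a + (n - d - t) = b + (n - d)" "a + Suc (n - d - t) = b + n"
        and lt: "n - d - t < l" "Suc (n - d - t) < l"
        using st that ud unfolding a_def l_def by auto
      show ?thesis unfolding nth[OF lt(1)] nth[OF lt(2)] a
        using cyclicD[OF cycF, of b] unimodal_plateaus(2)[OF cycF uni] by simp
    qed
    show "map F (arc n a l) ! Suc k < map F (arc n a l) ! k"
      if k: "n - d - t + Suc d \<le> Suc k \<and> Suc k < length (map F (arc n a l))" for k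
    proof -
      have kn: "n \<le> t + k" "Suc k < l" "n \<le> t + Suc k" using k st ud unfolding len by auto
      hence "Suc (t + k - n) < s" unfolding l_def using st by simp
      hence "F (b + Suc (t + k - n)) < F (b + (t + k - n))"
        using unimodal_decreasing[OF uni, of "t + k - n" "Suc (t + k - n)"] st by simp
      moreover have "t + Suc k - n = Suc (t + k - n)" using kn by simp
      ultimately show ?thesis using nth[of k] nth[of "Suc k"] kn wrap[of k] wrap[of "Suc k"] by simp
    qed
  qed
  ultimately show thesis using that l by blast
qed

lemma ones_scalar_prod:
  assumes "x \<in> carrier_vec n"
  shows "ones_vec n \<bullet> x = (\<Sum>i<n. unroll n x i)"
  using assms by (auto simp: ones_vec_def scalar_prod_def lessThan_atLeast0 intro!: sum.cong)

lemma induced_edges_zero_set: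
  assumes "0 < n"
  shows "induced_edges (cycle_edges n) (zero_set n x) = {} \<longleftrightarrow>
    (\<forall>i. \<not> (unroll n x i = 0 \<and> unroll n x (Suc i) = 0))"
proof
  assume empty: "induced_edges (cycle_edges n) (zero_set n x) = {}"
  show "\<forall>i. \<not> (unroll n x i = 0 \<and> unroll n x (Suc i) = 0)"
  proof (intro allI notI)
    fix i assume z: "unroll n x i = 0 \<and> unroll n x (Suc i) = 0"
    have "{i mod n, (i mod n + 1) mod n} \<in> cycle_edges n"
      using assms unfolding cycle_edges_def by (intro CollectI exI[of _ "i mod n"]) auto
    hence "{i mod n, (i mod n + 1) mod n} \<in> induced_edges (cycle_edges n) (zero_set n x)"
      using z assms by (auto simp: induced_edges_def zero_set_def unroll_def mod_Suc_eq)
    thus False using empty by simp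
  qed
next
  assume nz: "\<forall>i. \<not> (unroll n x i = 0 \<and> unroll n x (Suc i) = 0)"
  show "induced_edges (cycle_edges n) (zero_set n x) = {}"
  proof (rule ccontr)
    assume "induced_edges (cycle_edges n) (zero_set n x) \<noteq> {}"
    then obtain i where "i \<in> zero_set n x" "(i + 1) mod n \<in> zero_set n x"
      unfolding induced_edges_def cycle_edges_def by auto
    hence "unroll n x i = 0 \<and> unroll n x (Suc i) = 0" by (auto simp: zero_set_def unroll_def)
    thus False using nz by blast
  qed
qed

lemma periodic_if_unimodal:
  assumes x: "x \<in> carrier_vec n" and sum0: "(\<Sum>i<n. unroll n x i) = 0"
    and uni: "unimodal_from n (unroll n x) b j e d"
  shows "periodic n x"
proof -
  let ?F = "unroll n x"
  have cycF: "cyclic n ?F" by (rule cyclic_unroll)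
  note ud = unimodal_bounds[OF uni]
  have n: "0 < n" using ud by simp
  have peak: "0 < ?F b" using unimodal_peak_pos[OF cycF uni sum0] .
  have valley: "?F (b + j) < 0" using unimodal_valley_neg[OF cycF uni sum0] .
  have map_arc: "map (\<lambda>i. x $ i) (arc n a l) = map ?F (arc n a l)" for a l
    using n by (auto simp: arc_def)
  have P: "\<exists>vs. path_order (pos_set n x) (induced_edges (cycle_edges n) (pos_set n x)) vs \<and>
           up_down (map (\<lambda>i. x $ i) vs)"
  proof -
    obtain a l where al: "0 < l" "l < n" "{i. i < n \<and> 0 < ?F i} = set (arc n a l)" "up_down (map ?F (arc n a l))"
      using unimodal_positive_arc[OF cycF uni peak valley] .
    have "pos_set n x = {i. i < n \<and> 0 < ?F i}" by (auto simp: pos_set_def)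
    hence S: "pos_set n x = set (arc n a l)" unfolding al(3) .
    show ?thesis
      by (rule exI[of _ "arc n a l"], unfold S map_arc) (rule conjI[OF arc_path_order[OF al(1,2)] al(4)])
  qed
  have N: "\<exists>vs. path_order (neg_set n x) (induced_edges (cycle_edges n) (neg_set n x)) vs \<and>
           down_up (map (\<lambda>i. x $ i) vs)"
  proof -
    have cycN: "cyclic n (\<lambda>i. - ?F i)" using cycF by (simp add: cyclic_def)
    have N: "0 < - ?F (b + (j + e))" "- ?F (b + (j + e) + (n - d - (j + e))) < 0"
      using peak valley unimodal_plateaus[OF cycF uni] ud by auto
    obtain a l where al: "0 < l" "l < n" "{i. i < n \<and> 0 < - ?F i} = set (arc n a l)"
      "up_down (map (\<lambda>i. - ?F i) (arc n a l))"
      using unimodal_positive_arc[OF cycN unimodal_uminus[OF cycF uni] N] .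
    have "neg_set n x = {i. i < n \<and> 0 < - ?F i}" by (auto simp: neg_set_def)
    hence S: "neg_set n x = set (arc n a l)" unfolding al(3) .
    have D: "down_up (map (\<lambda>i. x $ i) (arc n a l))"
      using al(4) unfolding down_up_iff_up_down_uminus map_arc by (simp add: o_def)
    show ?thesis
      by (rule exI[of _ "arc n a l"], unfold S) (rule conjI[OF arc_path_order[OF al(1,2)] D])
  qed
  obtain s t where st: "0 < s" "s \<le> j" "j + e < t" "t \<le> n - d"
    and s_pos: "\<forall>k<s. 0 < ?F (b + k)" and st_neg: "\<forall>k. s \<le> k \<and> k < t \<longrightarrow> ?F (b + k) \<le> 0"
    and t_pos: "\<forall>k. t \<le> k \<and> k \<le> n \<longrightarrow> 0 < ?F (b + k)"
    and zero: "\<forall>k<n. ?F (b + k) = 0 \<longrightarrow> k = s \<or> k = t - 1"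
    using unimodal_signs[OF cycF uni peak valley] .
  have "zero_set n x \<subseteq> {(b + s) mod n, (b + (t - 1)) mod n}"
  proof
    fix i assume "i \<in> zero_set n x"
    hence i: "i < n" "?F i = 0" by (auto simp: zero_set_def)
    obtain k where k: "k < n" "i mod n = (b + k) mod n" using window_representative[OF n] .
    have "k = s \<or> k = t - 1" using zero k cyclic_cong[OF cycF k(2)] i by auto
    thus "i \<in> {(b + s) mod n, (b + (t - 1)) mod n}" using k i by auto
  qed
  hence "card (zero_set n x) \<le> card {(b + s) mod n, (b + (t - 1)) mod n}" by (intro card_mono) auto
  also have "\<dots> \<le> 2" by (simp add: card_insert_if)
  finally have C: "card (zero_set n x) \<le> 2" .
  have "\<not> (?F i = 0 \<and> ?F (Suc i) = 0)" for i
  proof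
    assume z: "?F i = 0 \<and> ?F (Suc i) = 0"
    obtain k where k: "k < n" "i mod n = (b + k) mod n" using window_representative[OF n] .
    have "Suc i mod n = (b + Suc k) mod n" using k(2) by (metis add_Suc_right mod_Suc_eq)
    hence z0: "?F (b + k) = 0" "?F (b + Suc k) = 0"
      using z cyclic_cong[OF cycF k(2)] cyclic_cong[OF cycF] by metis+
    have "Suc k \<noteq> n" using z0(2) peak cyclicD[OF cycF, of b] by auto
    hence "k = s \<or> k = t - 1" "Suc k = s \<or> Suc k = t - 1" using zero k z0 by auto
    hence "k = j \<or> Suc k = j" using st ud by auto
    thus False using z0 valley by auto
  qed
  thus ?thesis unfolding periodic_def induced_edges_zero_set[OF n]
    using P N C ones_scalar_prod[OF x] sum0 by simp
qed

text \<open>The list that runs along the path may follow the cycle in either direction, but the shape of its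
  values is invariant under reversal. Used for \<open>x\<close> on the positive and for \<open>- x\<close> on the negative
  vertices.\<close>

lemma periodic_path_arc:
  assumes S: "S \<subseteq> {..<n}" and po: "path_order S (induced_edges (cycle_edges n) S) vs"
    and ud: "up_down (map (\<lambda>i. y $ i) vs)"
  obtains a l u r where "0 < l" "\<forall>i. i < n \<longrightarrow> (i \<in> S \<longleftrightarrow> (\<exists>k<l. i = (a + k) mod n))"
    "r = 0 \<or> r = Suc 0" "u + r < l" "\<forall>k<u. unroll n y (a + k) < unroll n y (a + Suc k)"
    "unroll n y (a + (u + r)) = unroll n y (a + u)"
    "\<forall>k. u + r \<le> k \<and> Suc k < l \<longrightarrow> unroll n y (a + Suc k) < unroll n y (a + k)"
proof -
  obtain a where a: "vs = arc n a (length vs) \<or> rev vs = arc n a (length vs)"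
    using cycle_path_order_arc[OF po S] by blast
  define l where "l = length vs"
  have l: "0 < l" and set: "set vs = S" using po unfolding l_def path_order_def by auto
  have setS: "S = set (arc n a l)" using a set unfolding l_def[symmetric] by (metis set_rev)
  have "up_down (map (\<lambda>i. y $ i) (arc n a l))"
    using a ud up_down_rev[of "map (\<lambda>i. y $ i) vs"] unfolding l_def[symmetric] by (metis rev_map)
  then obtain u r where r: "r = 1 \<or> r = 2" "u + r \<le> length (arc n a l)"
    and inc: "\<forall>k<u. map (\<lambda>i. y $ i) (arc n a l) ! k < map (\<lambda>i. y $ i) (arc n a l) ! Suc k"
    and eq: "r = 2 \<longrightarrow> map (\<lambda>i. y $ i) (arc n a l) ! Suc u = map (\<lambda>i. y $ i) (arc n a l) ! u"
    and dec: "\<forall>k. u + r \<le> Suc k \<and> Suc k < length (arc n a l) \<longrightarrow>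
      map (\<lambda>i. y $ i) (arc n a l) ! Suc k < map (\<lambda>i. y $ i) (arc n a l) ! k"
    unfolding up_down_iff length_map by blast
  have len: "length (arc n a l) = l" by (simp add: arc_def)
  have nth: "map (\<lambda>i. y $ i) (arc n a l) ! k = unroll n y (a + k)" if "k < l" for k
    using that by (simp add: arc_def unroll_def)
  show thesis
  proof (rule that[of l a "r - 1" u])
    show "\<forall>i. i < n \<longrightarrow> (i \<in> S \<longleftrightarrow> (\<exists>k<l. i = (a + k) mod n))"
      unfolding setS arc_def by auto
    show "\<forall>k<u. unroll n y (a + k) < unroll n y (a + Suc k)" using inc r nth unfolding len by auto
    show "unroll n y (a + (u + (r - 1))) = unroll n y (a + u)" using eq r nth unfolding len by auto
    show "\<forall>k. u + (r - 1) \<le> k \<and> Suc k < l \<longrightarrow> unroll n y (a + Suc k) < unroll n y (a + k)"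
      using dec r nth unfolding len by auto
  qed (use l r len in auto)
qed


text \<open>Let the positive arc start at \<open>a\<close> and have length \<open>l\<close>, and let the negative arc start at
  \<open>c = a + m\<close> and have length \<open>l'\<close>. The vertices in the two gaps between them are zeros, and zeros
  are isolated, so each gap has at most one vertex. Hence \<open>F\<close> falls strictly from the peak over the
  first gap to the valley and rises strictly over the second gap to the next peak.\<close>

lemma unimodal_if_periodic:
  assumes n: "0 < n" and x: "x \<in> carrier_vec n" and per: "periodic n x"
  obtains b j e d where "unimodal_from n (unroll n x) b j e d"
proof -
  let ?F = "unroll n x"
  have cycF: "cyclic n ?F" by (rule cyclic_unroll)
  have perF: "?F (i + n) = ?F i" for i using cycF by (rule cyclicD)
  obtain vs where vs: "path_order (pos_set n x) (induced_edges (cycle_edges n) (pos_set n x)) vs"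
      "up_down (map (\<lambda>i. x $ i) vs)"
    using per unfolding periodic_def by blast
  obtain ws where ws: "path_order (neg_set n x) (induced_edges (cycle_edges n) (neg_set n x)) ws"
      "down_up (map (\<lambda>i. x $ i) ws)"
    using per unfolding periodic_def by blast
  have nz: "\<forall>i. \<not> (?F i = 0 \<and> ?F (Suc i) = 0)"
    using per induced_edges_zero_set[OF n] unfolding periodic_def by blast
  have negx: "unroll n (- x) i = - ?F i" for i using x n by (simp add: unroll_def)
  have wsn: "set ws \<subseteq> {..<n}" using ws(1) unfolding path_order_def neg_set_def by auto
  have neg_map: "map uminus (map (\<lambda>i. x $ i) ws) = map (\<lambda>i. (- x) $ i) ws" using wsn x by auto
  have ws': "up_down (map (\<lambda>i. (- x) $ i) ws)"
    using ws(2) unfolding down_up_iff_up_down_uminus neg_map .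
  obtain a l u r where l: "0 < l" and P: "\<forall>i. i < n \<longrightarrow> (i \<in> pos_set n x \<longleftrightarrow> (\<exists>k<l. i = (a + k) mod n))"
    and r: "r = 0 \<or> r = Suc 0" and ur: "u + r < l" and Pinc: "\<forall>k<u. ?F (a + k) < ?F (a + Suc k)"
    and Peq: "?F (a + (u + r)) = ?F (a + u)"
    and Pdec: "\<forall>k. u + r \<le> k \<and> Suc k < l \<longrightarrow> ?F (a + Suc k) < ?F (a + k)"
    by (rule periodic_path_arc[OF _ vs]) (auto simp: pos_set_def)
  obtain c0 l' u' r' where l': "0 < l'" and N: "\<forall>i. i < n \<longrightarrow> (i \<in> neg_set n x \<longleftrightarrow> (\<exists>k<l'. i = (c0 + k) mod n))"
    and r': "r' = 0 \<or> r' = Suc 0" and ur': "u' + r' < l'"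
    and Ninc0: "\<forall>k<u'. unroll n (- x) (c0 + k) < unroll n (- x) (c0 + Suc k)"
    and Neq0: "unroll n (- x) (c0 + (u' + r')) = unroll n (- x) (c0 + u')"
    and Ndec0: "\<forall>k. u' + r' \<le> k \<and> Suc k < l' \<longrightarrow> unroll n (- x) (c0 + Suc k) < unroll n (- x) (c0 + k)"
    by (rule periodic_path_arc[OF _ ws(1) ws']) (auto simp: neg_set_def)
  have posF: "0 < ?F i \<longleftrightarrow> (\<exists>k<l. i mod n = (a + k) mod n)" for i
    using P[rule_format, of "i mod n"] n by (simp add: pos_set_def unroll_def)
  have negF: "?F i < 0 \<longleftrightarrow> (\<exists>k<l'. i mod n = (c0 + k) mod n)" for i
    using N[rule_format, of "i mod n"] n by (simp add: neg_set_def unroll_def)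
  obtain m where m: "m < n" "c0 mod n = (a + m) mod n" using window_representative[OF n] .
  define c where "c = a + m"
  have c_mod: "(c0 + k) mod n = (c + k) mod n" for k
    using m(2) unfolding c_def by (metis mod_add_left_eq)
  have cF: "?F (c0 + k) = ?F (c + k)" for k using cyclic_cong[OF cycF c_mod] .
  have Ndec: "?F (c + Suc k) < ?F (c + k)" if "k < u'" for k using Ninc0 that by (simp only: negx cF neg_less_iff_less)
  have Neq: "?F (c + (u' + r')) = ?F (c + u')" using Neq0 by (simp only: negx cF neg_equal_iff_equal)
  have Ninc: "?F (c + k) < ?F (c + Suc k)" if "u' + r' \<le> k" "Suc k < l'" for k
    using Ndec0 that by (simp only: negx cF neg_less_iff_less)
  have pos: "0 < ?F (a + k)" if "k < l" for k using posF that by blast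
  have neg: "?F (c + k) < 0" if "k < l'" for k using negF c_mod that by metis
  have lm: "l \<le> m"
  proof (rule ccontr)
    assume "\<not> l \<le> m"
    thus False using pos[of m] neg[of 0] l' unfolding c_def by simp
  qed
  have ml': "m + l' \<le> n"
  proof (rule ccontr)
    assume "\<not> m + l' \<le> n"
    hence "?F (c + (n - m)) < 0" using m(1) by (intro neg) simp
    moreover have "c + (n - m) = a + n" using m(1) unfolding c_def by simp
    ultimately show False using perF[of a] pos[of 0] l by simp
  qed
  have zero: "?F (a + k) = 0" if k: "k < n" "l \<le> k" "k < m \<or> m + l' \<le> k" for k
  proof -
    have "\<not> 0 < ?F (a + k)"
    proof
      assume "0 < ?F (a + k)"
      then obtain k' where "k' < l" "(a + k) mod n = (a + k') mod n" using posF by blast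
      thus False using window_unique[of a k n k'] k lm m by simp
    qed
    moreover have "\<not> ?F (a + k) < 0"
    proof
      assume "?F (a + k) < 0"
      then obtain k' where "k' < l'" "(a + k) mod n = (a + (m + k')) mod n"
        using negF c_mod unfolding c_def by (metis add.assoc)
      thus False using window_unique[of a k n "m + k'"] k ml' by simp
    qed
    ultimately show ?thesis by simp
  qed
  have ml: "m \<le> Suc l"
  proof (rule ccontr)
    assume "\<not> m \<le> Suc l"
    thus False using zero[of l] zero[of "Suc l"] nz m by simp
  qed
  have nm: "n \<le> Suc (m + l')"
  proof (rule ccontr)
    assume "\<not> n \<le> Suc (m + l')"
    thus False using zero[of "m + l'"] zero[of "Suc (m + l')"] nz lm by simp
  qed
  have down: "?F (Suc (a + k)) < ?F (a + k)" if k: "u + r \<le> k" "k < m + u'" for k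
  proof -
    consider "Suc k < l" | "Suc k = l" "l = m" | "Suc k = l" "l < m" | "k = l" "l < m" | "m \<le> k"
      using k lm ml by linarith
    thus ?thesis
    proof cases
      case 1
      thus ?thesis using Pdec k by simp
    next
      case 2
      have "?F (a + l) < 0" using neg[of 0] l' 2 unfolding c_def by simp
      moreover have "a + l = Suc (a + k)" "k < l" using 2 by auto
      ultimately show ?thesis using pos[of k] by simp
    next
      case 3
      have "?F (a + l) = 0" using 3 m by (intro zero) auto
      moreover have "a + l = Suc (a + k)" "k < l" using 3 by auto
      ultimately show ?thesis using pos[of k] by simp
    next
      case 4
      have c: "Suc (a + l) = c" using 4 ml unfolding c_def by simp
      have "?F (Suc (a + l)) < 0" unfolding c using neg[of 0] l' by simp
      moreover have "?F (a + l) = 0" using 4 m by (intro zero) auto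
      ultimately show ?thesis using 4 by simp
    next
      case 5
      have "?F (c + Suc (k - m)) < ?F (c + (k - m))" using k 5 by (intro Ndec) simp
      thus ?thesis using 5 unfolding c_def by simp
    qed
  qed
  have up: "?F (a + k) < ?F (Suc (a + k))" if k: "m + (u' + r') \<le> k" "k < n + u" for k
  proof -
    have an: "?F (a + n) = ?F a" using perF .
    have a0: "0 < ?F a" using pos[of 0] l by simp
    consider "Suc k < m + l'" | "Suc k = m + l'" "m + l' = n" | "Suc k = m + l'" "m + l' < n"
      | "k = m + l'" "m + l' < n" | "n \<le> k" using nm ml' k by linarith
    thus ?thesis
    proof cases
      case 1
      have "?F (c + (k - m)) < ?F (c + Suc (k - m))" using k 1 by (intro Ninc) auto
      thus ?thesis using k unfolding c_def by simp
    next
      case 2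
      have "?F (c + (k - m)) < 0" using 2 l' by (intro neg) simp
      moreover have "c + (k - m) = a + k" using k unfolding c_def by simp
      ultimately have "?F (a + k) < 0" by simp
      moreover have S: "Suc (a + k) = a + n" using 2 by simp
      ultimately show ?thesis unfolding S an using a0 by linarith
    next
      case 3
      have "?F (c + (k - m)) < 0" using 3 l' by (intro neg) simp
      moreover have "c + (k - m) = a + k" using k unfolding c_def by simp
      moreover have "?F (a + Suc k) = 0" using 3 lm by (intro zero) auto
      ultimately show ?thesis by simp
    next
      case 4
      have "?F (a + k) = 0" using 4 lm by (intro zero) auto
      moreover have S: "Suc (a + k) = a + n" using 4 nm by simp
      ultimately show ?thesis unfolding S an using a0 by linarith
    next
      case 5
      have "?F (a + (k - n)) < ?F (a + Suc (k - n))" using k 5 by (intro Pinc[rule_format]) linarith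
      moreover have "a + k = a + (k - n) + n" "Suc (a + k) = a + Suc (k - n) + n" using 5 by auto
      ultimately show ?thesis using perF by metis
    qed
  qed
  define b where "b = a + (u + r)"
  define j where "j = m + u' - (u + r)"
  have bj: "b + j = c + u'" and j: "0 < j" "j + r' + r < n"
    using ur lm ur' ml' unfolding b_def j_def c_def by auto
  have "unimodal_from n ?F b j r' r"
    unfolding unimodal_from_def
  proof (intro conjI allI impI)
    show "0 < j" "r' \<le> 1" "r \<le> 1" "j + r' + r < n" using j r r' by auto
    show "?F (Suc (b + k)) < ?F (b + k)" if "k < j" for k
      using down[of "u + r + k"] that unfolding b_def j_def by (simp add: add.assoc)
    show "?F (Suc (b + j)) = ?F (b + j)" if "r' = 1"
      using Neq that unfolding bj by simp
    show "?F (b + k) < ?F (Suc (b + k))" if "j + r' \<le> k \<and> k < n - r" for k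
    proof -
      have "m + (u' + r') \<le> u + r + k" "u + r + k < n + u"
        using that lm ur unfolding j_def by linarith+
      from up[OF this] show ?thesis unfolding b_def by (simp add: add.assoc)
    qed
    show "?F (b + n) = ?F (b + (n - 1))" if "r = 1"
    proof -
      have "b + (n - 1) = (a + u) + n" using that n unfolding b_def by simp
      thus ?thesis using perF Peq unfolding b_def by metis
    qed
  qed
  thus thesis by (rule that)
qed

section \<open>Peaks, valleys and balance\<close>

text \<open>This is where \<open>n \<ge> 3\<close> matters for peaks and valleys: on two vertices each would follow the other.\<close>

lemma first_last_unique:
  assumes n: "3 \<le> n" and "first_last n S a a'" "first_last n S c c'"
  shows "a = c \<and> a' = c'"
proof -
  have "{a, a'} = {c, c'}" and lt: "a < n" "c < n" and a': "a' = a \<or> a' = Suc a mod n"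
    and c': "c' = c \<or> c' = Suc c mod n"
    using assms(2,3) unfolding first_last_def by auto
  hence "(a = c \<and> a' = c') \<or> (a = c' \<and> a' = c)" by (auto simp: doubleton_eq_iff)
  thus ?thesis
    using a' c' Suc_Suc_mod_neq[OF n lt(1)] by auto
qed

lemma maximizers_first_last:
  assumes n: "2 \<le> n" and d: "d = 0 \<or> d = 1"
  shows "first_last n {(b + (n - d)) mod n, b mod n} ((b + (n - d)) mod n) (b mod n)"
    and "card {(b + (n - d)) mod n, b mod n} = 1 \<longleftrightarrow> d = 0"
proof -
  have "Suc ((b + (n - 1)) mod n) mod n = b mod n"
  proof -
    have "Suc ((b + (n - 1)) mod n) mod n = (b + n) mod n" using n by (simp add: mod_Suc_eq)
    thus ?thesis by simp
  qed
  moreover from this have "(b + (n - 1)) mod n \<noteq> b mod n"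
    using Suc_mod_neq[OF n, of "(b + (n - 1)) mod n"] n by auto
  ultimately show "first_last n {(b + (n - d)) mod n, b mod n} ((b + (n - d)) mod n) (b mod n)"
    and "card {(b + (n - d)) mod n, b mod n} = 1 \<longleftrightarrow> d = 0"
    using d n by (auto simp: first_last_def)
qed

lemma peaks_eq:
  assumes "0 < n"
  shows "peaks n x = {i. i < n \<and> (\<forall>k<n. unroll n x k \<le> unroll n x i)}"
proof -
  have "(x $ i = Max ((\<lambda>j. x $ j) ` {..<n})) \<longleftrightarrow> (\<forall>k<n. x $ k \<le> x $ i)" if "i < n" for i
    using that assms by (auto intro!: Max_eqI[symmetric])
  thus ?thesis unfolding peaks_def by auto
qed

lemma valleys_eq:
  assumes "0 < n"
  shows "valleys n x = {i. i < n \<and> (\<forall>k<n. - unroll n x k \<le> - unroll n x i)}"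
proof -
  have "(x $ i = Min ((\<lambda>j. x $ j) ` {..<n})) \<longleftrightarrow> (\<forall>k<n. x $ i \<le> x $ k)" if "i < n" for i
    using that assms by (auto intro!: Min_eqI[symmetric])
  thus ?thesis unfolding valleys_def by auto
qed

text \<open>The existentially quantified \<open>p\<close>, \<open>p'\<close>, \<open>q\<close>, \<open>q'\<close> are determined by the shape of the vector.\<close>

lemma balanced_iff_unimodal:
  assumes n: "3 \<le> n" and uni: "unimodal_from n (unroll n x) b j e d"
  shows "balanced n x \<longleftrightarrow> (if d = 0 \<or> e = 0
    then (\<Sum>i\<in>cyc_oc n ((b + (n - d)) mod n) ((b + j) mod n). x $ i) < 0 \<and>
         0 < (\<Sum>i\<in>cyc_co n (b mod n) ((b + (j + e)) mod n). x $ i)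
    else (\<Sum>i\<in>cyc_oc n ((b + (n - d)) mod n) ((b + j) mod n). x $ i) = 0 \<and>
         0 = (\<Sum>i\<in>cyc_co n (b mod n) ((b + (j + e)) mod n). x $ i))"
proof -
  note ud = unimodal_bounds[OF uni]
  have n0: "0 < n" and n2: "2 \<le> n" using n by auto
  have cycF: "cyclic n (unroll n x)" by (rule cyclic_unroll)
  have peaks: "peaks n x = {(b + (n - d)) mod n, b mod n}"
    unfolding peaks_eq[OF n0] by (rule unimodal_maximizers[OF cycF uni])
  have "(b + (j + e) + (n - e)) mod n = (b + j) mod n"
  proof -
    have "b + (j + e) + (n - e) = b + j + n" using ud by simp
    thus ?thesis by (simp only: mod_add_self2)
  qed
  moreover have "cyclic n (\<lambda>i. - unroll n x i)" using cycF by (simp add: cyclic_def)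
  ultimately have valleys: "valleys n x = {(b + j) mod n, (b + (j + e)) mod n}"
    unfolding valleys_eq[OF n0] using unimodal_maximizers[OF _ unimodal_uminus[OF cycF uni]] by simp
  note P = maximizers_first_last[OF n2 ud(3), of b, folded peaks]
  have Q: "first_last n (valleys n x) ((b + j) mod n) ((b + (j + e)) mod n)" "card (valleys n x) = 1 \<longleftrightarrow> e = 0"
    using maximizers_first_last[OF n2 ud(2), of "b + (j + e)"] \<open>(b + (j + e) + (n - e)) mod n = (b + j) mod n\<close>
    unfolding valleys by simp_all
  have "first_last n (peaks n x) p p' \<longleftrightarrow> p = (b + (n - d)) mod n \<and> p' = b mod n" for p p'
    using first_last_unique[OF n _ P(1)] P(1) by blast
  moreover have "first_last n (valleys n x) q q' \<longleftrightarrow> q = (b + j) mod n \<and> q' = (b + (j + e)) mod n" for q q'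
    using first_last_unique[OF n _ Q(1)] Q(1) by blast
  ultimately show ?thesis
    unfolding balanced_def P(2) Q(2) by simp
qed

lemma sum_telescope_flux:
  fixes F D :: "nat \<Rightarrow> real"
  assumes "\<And>i. D i - D (Suc i) = c * F (Suc i)"
  shows "c * (\<Sum>k<m. F (Suc (a + k))) = D a - D (a + m)"
proof (induction m)
  case (Suc m)
  thus ?case using assms[of "a + m"] by (simp add: distrib_left)
qed simp

text \<open>The reason why balance is a condition on fluxes: the sum over \<open>(p, q]\<close> is the flux lost between
  the edge after \<open>p\<close> and the edge after \<open>q\<close>.\<close>

lemma cyc_oc_flux:
  assumes n: "0 < n" and cycD: "cyclic n D" and flux: "\<And>i. D i - D (Suc i) = c * unroll n x (Suc i)"
  shows "c * (\<Sum>i\<in>cyc_oc n (p mod n) (q mod n). x $ i) = D p - D q"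
proof -
  define L where "L = (q mod n + n - p mod n) mod n"
  have L: "L < n" using n by (simp add: L_def)
  have set: "cyc_oc n (p mod n) (q mod n) = (\<lambda>k. Suc (p mod n + k) mod n) ` {..<L}"
    unfolding cyc_oc_def L_def[symmetric]
  proof (intro equalityI subsetI)
    fix i assume "i \<in> {(p mod n + k) mod n |k. 0 < k \<and> k \<le> L}"
    then obtain k where "i = (p mod n + k) mod n" "0 < k" "k \<le> L" by auto
    thus "i \<in> (\<lambda>k. Suc (p mod n + k) mod n) ` {..<L}" by (intro image_eqI[of _ _ "k - 1"]) auto
  next
    fix i assume "i \<in> (\<lambda>k. Suc (p mod n + k) mod n) ` {..<L}"
    then obtain k where "i = (p mod n + Suc k) mod n" "k < L" by auto
    thus "i \<in> {(p mod n + k) mod n |k. 0 < k \<and> k \<le> L}" by (intro CollectI exI[of _ "Suc k"]) auto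
  qed
  have inj: "inj_on (\<lambda>k. Suc (p mod n + k) mod n) {..<L}"
    by (intro inj_onI, rule window_unique[of "Suc (p mod n)" _ n]) (use L in auto)
  have "(\<Sum>i\<in>cyc_oc n (p mod n) (q mod n). x $ i) = (\<Sum>k<L. unroll n x (Suc (p mod n + k)))"
    unfolding set by (simp add: sum.reindex[OF inj] unroll_def)
  also have "c * \<dots> = D (p mod n) - D (p mod n + L)"
    by (rule sum_telescope_flux) (rule flux)
  also have "D (p mod n + L) = D q"
  proof (rule cyclic_cong[OF cycD])
    have "p mod n < n" using n by simp
    hence "p mod n + (q mod n + n - p mod n) = q mod n + n" by simp
    thus "(p mod n + L) mod n = q mod n" unfolding L_def by (simp add: mod_add_right_eq)
  qed
  finally show ?thesis using cyclic_mod[OF cycD] by simp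
qed

text \<open>The same for the edges before \<open>p\<close> and before \<open>q\<close>; adding \<open>n - 1\<close> steps back by one modulo \<open>n\<close>.\<close>

lemma cyc_co_flux:
  assumes n: "0 < n" and cycD: "cyclic n D" and flux: "\<And>i. D i - D (Suc i) = c * unroll n x (Suc i)"
  shows "c * (\<Sum>i\<in>cyc_co n (p mod n) (q mod n). x $ i) = D (p + (n - 1)) - D (q + (n - 1))"
proof -
  define L where "L = (q mod n + n - p mod n) mod n"
  have L: "L < n" using n by (simp add: L_def)
  have set: "cyc_co n (p mod n) (q mod n) = (\<lambda>k. (p mod n + k) mod n) ` {..<L}"
    unfolding cyc_co_def L_def[symmetric] by auto
  have inj: "inj_on (\<lambda>k. (p mod n + k) mod n) {..<L}"
    by (intro inj_onI, rule window_unique[of "p mod n" _ n]) (use L in auto)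
  have "(\<Sum>i\<in>cyc_co n (p mod n) (q mod n). x $ i) = (\<Sum>k<L. unroll n x (Suc (p mod n + (n - 1) + k)))"
  proof -
    have "Suc (p mod n + (n - 1) + k) mod n = (p mod n + k) mod n" for k
    proof -
      have "Suc (p mod n + (n - 1) + k) = p mod n + k + n" using n by simp
      thus ?thesis by (simp only: mod_add_self2)
    qed
    thus ?thesis unfolding set by (simp add: sum.reindex[OF inj] unroll_def)
  qed
  also have "c * \<dots> = D (p mod n + (n - 1)) - D (p mod n + (n - 1) + L)"
    by (rule sum_telescope_flux) (rule flux)
  also have "D (p mod n + (n - 1)) = D (p + (n - 1))"
    by (rule cyclic_cong[OF cycD]) (simp add: mod_add_left_eq)
  also have "D (p mod n + (n - 1) + L) = D (q + (n - 1))"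
  proof (rule cyclic_cong[OF cycD])
    have "p mod n < n" using n by simp
    hence "p mod n + (n - 1) + (q mod n + n - p mod n) = q mod n + (n - 1) + n" by linarith
    hence "(p mod n + (n - 1) + L) mod n = (q mod n + (n - 1) + n) mod n" unfolding L_def by (simp only: mod_add_right_eq)
    thus "(p mod n + (n - 1) + L) mod n = (q + (n - 1)) mod n" by (simp add: mod_add_left_eq)
  qed
  finally show ?thesis .
qed

section \<open>Weighted Laplacians of the cycle\<close>

definition weights :: "nat \<Rightarrow> real mat \<Rightarrow> nat \<Rightarrow> real" where
  "weights n A i = - A $$ (i mod n, Suc i mod n)"

lemma laplacian_props:
  assumes A: "A \<in> weighted_laplacians n (cycle_edges n)"
  shows "A \<in> carrier_mat n n" "transpose_mat A = A"
    "\<And>i j. i < n \<Longrightarrow> j < n \<Longrightarrow> A $$ (i, j) = A $$ (j, i)"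
    "\<And>i j. i < n \<Longrightarrow> j < n \<Longrightarrow> i \<noteq> j \<Longrightarrow> {i, j} \<in> cycle_edges n \<Longrightarrow> A $$ (i, j) < 0"
    "\<And>i j. i < n \<Longrightarrow> j < n \<Longrightarrow> i \<noteq> j \<Longrightarrow> {i, j} \<notin> cycle_edges n \<Longrightarrow> A $$ (i, j) = 0"
    "\<And>i. i < n \<Longrightarrow> (\<Sum>j<n. A $$ (i, j)) = 0"
proof -
  from A have c: "A \<in> carrier_mat n n" and t: "transpose_mat A = A" and o: "A *\<^sub>v ones_vec n = 0\<^sub>v n"
    by (auto simp: weighted_laplacians_def)
  show "A \<in> carrier_mat n n" "transpose_mat A = A" by fact+
  show "A $$ (i, j) = A $$ (j, i)" if "i < n" "j < n" for i j
    using arg_cong[OF t, of "\<lambda>M. M $$ (i,j)"] that c by auto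
  show "A $$ (i, j) < 0" if "i < n" "j < n" "i \<noteq> j" "{i, j} \<in> cycle_edges n" for i j
    using A that unfolding weighted_laplacians_def by (auto split: if_splits)
  show "A $$ (i, j) = 0" if "i < n" "j < n" "i \<noteq> j" "{i, j} \<notin> cycle_edges n" for i j
    using A that unfolding weighted_laplacians_def by (auto split: if_splits)
  show "(\<Sum>j<n. A $$ (i, j)) = 0" if "i < n" for i
    using arg_cong[OF o, of "\<lambda>v. v $ i"] that c
    by (auto simp: ones_vec_def scalar_prod_def lessThan_atLeast0)
qed

lemma cyclic_weights: "cyclic n (weights n A)"
  unfolding cyclic_def weights_def by (simp flip: add_Suc)

lemma weights_pos:
  assumes n: "3 \<le> n" and A: "A \<in> weighted_laplacians n (cycle_edges n)"
  shows "0 < weights n A i"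
proof -
  have "Suc i mod n = Suc (i mod n) mod n" by (simp add: mod_Suc_eq)
  thus ?thesis
    using laplacian_props(4)[OF A, of "i mod n" "Suc i mod n"] n Suc_mod_neq[of n "i mod n"]
    by (simp add: weights_def cycle_edge_iff)
qed

text \<open>As the rows of \<open>A\<close> sum to zero, \<open>(A y)\<^sub>v\<close> is the sum of \<open>A\<^sub>v\<^sub>j (y\<^sub>j - y\<^sub>v)\<close>, to which
  only the two neighbours of \<open>v\<close> contribute. They are different because \<open>n \<ge> 3\<close>.\<close>

lemma laplacian_mult_vec:
  assumes n: "3 \<le> n" and A: "A \<in> weighted_laplacians n (cycle_edges n)" and y: "y \<in> carrier_vec n"
  shows "(A *\<^sub>v y) $ (Suc i mod n) =
    weights n A i * (unroll n y (Suc i) - unroll n y i)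
    - weights n A (Suc i) * (unroll n y (Suc (Suc i)) - unroll n y (Suc i))"
proof -
  note lp = laplacian_props[OF A]
  define u v t where "u = i mod n" and "v = Suc i mod n" and "t = Suc (Suc i) mod n"
  have lt: "u < n" "v < n" "t < n" using n by (auto simp: u_def v_def t_def)
  have v: "v = Suc u mod n" and t: "t = Suc v mod n" by (simp_all add: u_def v_def t_def mod_Suc_eq)
  have neq: "u \<noteq> v" "v \<noteq> t" "u \<noteq> t"
    using Suc_mod_neq[of n u] Suc_mod_neq[of n v] Suc_Suc_mod_neq[OF n lt(1)] n lt unfolding t v by auto
  have edge: "{v, j} \<in> cycle_edges n \<longleftrightarrow> j = u \<or> j = t" if "j < n" for j
  proof -
    have "v = Suc j mod n \<longleftrightarrow> j = u" using Suc_mod_inj[of u n j] lt that v by auto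
    thus ?thesis using cycle_edge_iff[OF lt(2) that] t by auto
  qed
  have "(A *\<^sub>v y) $ v = (\<Sum>j<n. A $$ (v, j) * y $ j)"
    using lt lp(1) y by (auto simp: scalar_prod_def lessThan_atLeast0)
  also have "\<dots> = (\<Sum>j<n. A $$ (v, j) * y $ j) - (\<Sum>j<n. A $$ (v, j)) * y $ v"
    using lp(6)[OF lt(2)] by simp
  also have "\<dots> = (\<Sum>j<n. A $$ (v, j) * (y $ j - y $ v))"
    by (simp add: sum_distrib_right sum_subtractf right_diff_distrib)
  also have "\<dots> = (\<Sum>j\<in>{u, t}. A $$ (v, j) * (y $ j - y $ v))"
  proof (rule sum.mono_neutral_right)
    show "\<forall>j\<in>{..<n} - {u, t}. A $$ (v, j) * (y $ j - y $ v) = 0"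
      using lp(5)[OF lt(2)] edge by force
  qed (use lt in auto)
  also have "\<dots> = A $$ (v, u) * (y $ u - y $ v) + A $$ (v, t) * (y $ t - y $ v)"
    using neq by simp
  also have "A $$ (v, u) = - weights n A i"
    using lp(3)[OF lt(2,1)] by (simp add: weights_def u_def v_def)
  also have "A $$ (v, t) = - weights n A (Suc i)"
    by (simp add: weights_def t_def v_def)
  finally show ?thesis
    by (simp add: unroll_def u_def v_def t_def algebra_simps)
qed

lemma eigenvector_iff_cycle_eigenfunction:
  assumes n: "3 \<le> n" and A: "A \<in> weighted_laplacians n (cycle_edges n)" and y: "y \<in> carrier_vec n"
  shows "A *\<^sub>v y = c \<cdot>\<^sub>v y \<longleftrightarrow> cycle_eigenfunction (weights n A) c (unroll n y)"
proof
  assume eq: "A *\<^sub>v y = c \<cdot>\<^sub>v y"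
  show "cycle_eigenfunction (weights n A) c (unroll n y)"
    unfolding cycle_eigenfunction_def laplacian_mult_vec[OF assms, symmetric] eq
    using y n by (simp add: unroll_def)
next
  assume eig: "cycle_eigenfunction (weights n A) c (unroll n y)"
  have "(A *\<^sub>v y) $ v = (c \<cdot>\<^sub>v y) $ v" if v: "v < n" for v
  proof -
    have s: "Suc (v + (n - 1)) mod n = v" using v by simp
    show ?thesis
      using laplacian_mult_vec[OF assms, of "v + (n - 1)", unfolded s]
        eig[unfolded cycle_eigenfunction_def, rule_format, of "v + (n - 1)"] v y s
      by (simp add: unroll_def)
  qed
  thus "A *\<^sub>v y = c \<cdot>\<^sub>v y"
    using y laplacian_props(1)[OF A] by (intro eq_vecI) auto
qed

lemma laplacian_quadratic_form:
  assumes n: "3 \<le> n" and A: "A \<in> weighted_laplacians n (cycle_edges n)" and y: "y \<in> carrier_vec n"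
  shows "y \<bullet> (A *\<^sub>v y) = (\<Sum>i<n. weights n A i * (unroll n y (Suc i) - unroll n y i)\<^sup>2)"
proof -
  let ?Y = "unroll n y" and ?D = "\<lambda>i. weights n A i * (unroll n y (Suc i) - unroll n y i)"
  have cyc: "cyclic n ?Y" "cyclic n (weights n A)" by (rule cyclic_unroll, rule cyclic_weights)
  have Ay: "A *\<^sub>v y \<in> carrier_vec n" using laplacian_props(1)[OF A] y by auto
  have "y \<bullet> (A *\<^sub>v y) = (\<Sum>i<n. ?Y i * unroll n (A *\<^sub>v y) i)"
    using carrier_vecD[OF Ay] unfolding scalar_prod_def[of y] lessThan_atLeast0
    by (intro sum.cong) auto
  also have "\<dots> = (\<Sum>i<n. ?Y (Suc i) * unroll n (A *\<^sub>v y) (Suc i))"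
    by (rule sum_cyclic_Suc[symmetric]) (use cyc cyclic_unroll in \<open>simp add: cyclic_def\<close>)
  also have "\<dots> = (\<Sum>i<n. ?Y (Suc i) * ?D i - ?Y (Suc i) * ?D (Suc i))"
    using laplacian_mult_vec[OF assms] by (simp add: unroll_def right_diff_distrib)
  also have "\<dots> = (\<Sum>i<n. ?Y (Suc i) * ?D i) - (\<Sum>i<n. ?Y i * ?D i)"
    using sum_cyclic_Suc[of n "\<lambda>i. ?Y i * ?D i"] cyclicD[OF cyc(1)] cyclicD[OF cyc(1), of "Suc _"] cyclicD[OF cyc(2)]
    by (simp add: cyclic_def sum_subtractf)
  also have "\<dots> = (\<Sum>i<n. weights n A i * (?Y (Suc i) - ?Y i)\<^sup>2)"
    unfolding sum_subtractf[symmetric] by (intro sum.cong refl) (simp add: power2_eq_square algebra_simps)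
  finally show ?thesis .
qed

text \<open>In the matrix below, \<open>i + (n - 1)\<close> is the edge that ends at \<open>i\<close>.\<close>

lemma laplacian_with_weights:
  assumes n: "3 \<le> n" and cycw: "cyclic n w" and pos: "\<And>i. 0 < w i"
  obtains A where "A \<in> weighted_laplacians n (cycle_edges n)" "weights n A = w"
proof
  define A where "A = mat n n (\<lambda>(i, j). if i = j then w i + w (i + (n - 1))
    else if j = Suc i mod n then - w i else if i = Suc j mod n then - w j else 0)"
  have sym: "transpose_mat A = A"
    unfolding A_def
  proof (rule eq_matI)
    fix i j assume "i < dim_row (mat n n (\<lambda>(i, j). if i = j then w i + w (i + (n - 1))
      else if j = Suc i mod n then - w i else if i = Suc j mod n then - w j else 0))"
      "j < dim_col (mat n n (\<lambda>(i, j). if i = j then w i + w (i + (n - 1))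
      else if j = Suc i mod n then - w i else if i = Suc j mod n then - w j else 0))"
    hence ij: "i < n" "j < n" by auto
    thus "transpose_mat (mat n n (\<lambda>(i, j). if i = j then w i + w (i + (n - 1))
      else if j = Suc i mod n then - w i else if i = Suc j mod n then - w j else 0)) $$ (i, j) =
      mat n n (\<lambda>(i, j). if i = j then w i + w (i + (n - 1))
      else if j = Suc i mod n then - w i else if i = Suc j mod n then - w j else 0) $$ (i, j)"
      using Suc_Suc_mod_neq[OF n, of i] Suc_Suc_mod_neq[OF n, of j] by auto
  qed auto
  have rows: "A *\<^sub>v ones_vec n = 0\<^sub>v n"
  proof (rule eq_vecI)
    fix i assume "i < dim_vec (0\<^sub>v n)"
    hence i: "i < n" by simp
    define s p where "s = Suc i mod n" and "p = (i + (n - 1)) mod n"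
    have lt: "s < n" "p < n" using n by (auto simp: s_def p_def)
    have p: "Suc p mod n = i"
    proof -
      have "Suc p mod n = (i + n) mod n" using n unfolding p_def by (simp add: mod_Suc_eq)
      thus ?thesis using i by simp
    qed
    have p_iff: "i = Suc j mod n \<longleftrightarrow> j = p" if "j < n" for j
    proof
      assume "i = Suc j mod n"
      with p have "Suc j mod n = Suc p mod n" by (simp only:)
      thus "j = p" using that lt(2) by (rule Suc_mod_inj)
    next
      assume "j = p"
      thus "i = Suc j mod n" using p by (simp only:)
    qed
    have neq: "s \<noteq> i" "p \<noteq> i" "s \<noteq> p"
    proof -
      have n2: "2 \<le> n" using n by simp
      show "s \<noteq> i" unfolding s_def by (rule Suc_mod_neq[OF n2 i])
      show "p \<noteq> i" using Suc_mod_neq[OF n2 lt(2)] unfolding p by (rule not_sym)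
      show "s \<noteq> p" using Suc_Suc_mod_neq[OF n lt(2)] unfolding p s_def .
    qed
    have wp: "w p = w (i + (n - 1))" unfolding p_def by (rule cyclic_mod[OF cycw])
    have "(A *\<^sub>v ones_vec n) $ i = (\<Sum>j<n. A $$ (i, j))"
      using i by (auto simp: A_def ones_vec_def scalar_prod_def lessThan_atLeast0)
    also have "\<dots> = (\<Sum>j\<in>{i, s, p}. A $$ (i, j))"
    proof (rule sum.mono_neutral_right)
      show "\<forall>j\<in>{..<n} - {i, s, p}. A $$ (i, j) = 0"
        using i p_iff by (auto simp: A_def s_def)
    qed (use lt i in auto)
    also have "\<dots> = A $$ (i, i) + A $$ (i, s) + A $$ (i, p)" using neq by simp
    also have "A $$ (i, i) = w i + w p" using i wp by (simp add: A_def)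
    also have "A $$ (i, s) = - w i" using i lt neq by (simp add: A_def s_def)
    also have "A $$ (i, p) = - w p" using i lt neq p by (simp add: A_def s_def)
    finally show "(A *\<^sub>v ones_vec n) $ i = 0\<^sub>v n $ i" using i by simp
  qed (simp add: A_def)
  show "A \<in> weighted_laplacians n (cycle_edges n)"
    unfolding weighted_laplacians_def
  proof (intro CollectI conjI allI impI)
    show "A \<in> carrier_mat n n" by (simp add: A_def)
    show "if {i, j} \<in> cycle_edges n then A $$ (i, j) < 0 else A $$ (i, j) = 0"
      if "i < n" "j < n" "i \<noteq> j" for i j
      using that pos cycle_edge_iff[of i n j] by (auto simp: A_def)
  qed (use sym rows in auto)
  show "weights n A = w"
  proof
    fix i
    have "Suc i mod n = Suc (i mod n) mod n" by (simp add: mod_Suc_eq)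
    thus "weights n A i = w i"
      using n Suc_mod_neq[of n "i mod n"] cyclic_mod[OF cycw, of i] by (auto simp: weights_def A_def)
  qed
qed

text \<open>The form is a sum of nonnegative terms, one for each edge, so all differences along edges
  vanish.\<close>

lemma laplacian_nonpos_form_constant:
  assumes n: "3 \<le> n" and A: "A \<in> weighted_laplacians n (cycle_edges n)" and y: "y \<in> carrier_vec n"
    and le: "y \<bullet> (A *\<^sub>v y) \<le> 0" and i: "i < n"
  shows "y $ i = y $ 0"
proof -
  let ?Y = "unroll n y"
  have T: "0 \<le> weights n A i * (?Y (Suc i) - ?Y i)\<^sup>2" for i
    using weights_pos[OF n A, of i] by simp
  have "(\<Sum>i<n. weights n A i * (?Y (Suc i) - ?Y i)\<^sup>2) = 0"
    using le unfolding laplacian_quadratic_form[OF n A y] by (intro antisym sum_nonneg T)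
  hence zero: "weights n A i * (?Y (Suc i) - ?Y i)\<^sup>2 = 0" if "i < n" for i
    by (rule sum_nonneg_0[OF finite_lessThan T]) (use that in auto)
  hence step: "?Y (Suc i) = ?Y i" if "i < n" for i
    using weights_pos[OF n A, of i] zero[OF that] by simp
  have "k \<le> n \<Longrightarrow> ?Y k = ?Y 0" for k by (induction k) (use step in auto)
  from this[of i] i show ?thesis by simp
qed


lemma unroll_vec:
  assumes "cyclic n f" "0 < n"
  shows "unroll n (vec n f) = f"
  using assms cyclic_mod[OF assms(1)] by (auto simp: unroll_def)

lemma vec_scalar_prod_self:
  assumes "y \<in> carrier_vec n"
  shows "y \<bullet> y = (\<Sum>i<n. (unroll n y i)\<^sup>2)"
  using assms by (auto simp: scalar_prod_def power2_eq_square lessThan_atLeast0)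

text \<open>Otherwise the first two vectors of the orthonormal eigenbasis would both have nonpositive energy
  and hence be constant, and two nonzero constant vectors are not orthogonal.\<close>

lemma second_eigenvalue_pos:
  assumes n: "3 \<le> n" and A: "A \<in> weighted_laplacians n (cycle_edges n)"
    and P: "P \<in> carrier_mat n n" and PP: "transpose_mat P * P = 1\<^sub>m n"
    and AP: "A * P = P * mat_diag n \<mu>" and mono: "\<mu> 0 \<le> \<mu> 1"
  shows "0 < \<mu> 1"
proof (rule ccontr)
  assume neg: "\<not> 0 < \<mu> 1"
  note Ac = laplacian_props(1)[OF A]
  have const: "col P k $ i = col P k $ 0" if k: "k < 2" and i: "i < n" for k i
  proof (rule laplacian_nonpos_form_constant[OF n A _ _ i])
    have kn: "k < n" using k n by simp
    have col: "col P k = P *\<^sub>v unit_vec n k" 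
      by (rule eq_vecI) (use P kn in \<open>auto simp: scalar_prod_right_unit[of k n]\<close>)
    have "k = 0 \<or> k = 1" using k by auto
    hence "\<mu> k \<le> 0" using neg mono by auto
    hence "col P k \<bullet> (A *\<^sub>v col P k) \<le> 0 * (col P k \<bullet> col P k)"
      unfolding col by (intro rayleigh_upper_bound[OF Ac P PP AP]) (auto simp: kn split: if_splits)
    thus "col P k \<bullet> (A *\<^sub>v col P k) \<le> 0" by simp
    show "col P k \<in> carrier_vec n" using P kn by auto
  qed
  have prod: "col P k \<bullet> col P l = real n * (col P k $ 0 * col P l $ 0)" if "k < 2" "l < 2" for k l
  proof -
    have "col P k \<bullet> col P l = (\<Sum>i<n. col P k $ i * col P l $ i)"
      using P by (auto simp: scalar_prod_def lessThan_atLeast0)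
    also have "\<dots> = (\<Sum>i<n. col P k $ 0 * col P l $ 0)"
    proof (rule sum.cong[OF refl])
      fix i assume "i \<in> {..<n}"
      hence "i < n" by simp
      from const[OF that(1) this] const[OF that(2) this]
      show "col P k $ i * col P l $ i = col P k $ 0 * col P l $ 0" by (simp only:)
    qed
    finally show ?thesis by simp
  qed
  have "col P k \<bullet> col P l = (if k = l then 1 else 0)" if "k < 2" "l < 2" for k l
    using arg_cong[OF PP, of "\<lambda>M. M $$ (k, l)"] that P n by auto
  hence "real n * (col P 0 $ 0 * col P 0 $ 0) = 1" "real n * (col P 1 $ 0 * col P 1 $ 0) = 1"
    "real n * (col P 0 $ 0 * col P 1 $ 0) = 0"
    using prod[of 0 0] prod[of 1 1] prod[of 0 1] by auto
  thus False by auto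
qed

text \<open>The first two vectors of an eigenbasis supply the two orthogonality conditions of
  \<open>no_four_sign_changes\<close>, both for the second and for the third eigenvalue.\<close>

lemma periodic_balanced_if_eigenvector:
  assumes n: "3 \<le> n" and x: "x \<in> carrier_vec n" and A: "A \<in> weighted_laplacians n (cycle_edges n)"
    and ev: "eigenvector A x c" and c: "c = kth_eigenvalue 2 A \<or> c = kth_eigenvalue 3 A"
  shows "periodic n x \<and> balanced n x"
proof -
  note Ac = laplacian_props(1,2)[OF A]
  define \<mu> where "\<mu> i = kth_eigenvalue (Suc i) A" for i
  obtain P where P: "P \<in> carrier_mat n n" "transpose_mat P * P = 1\<^sub>m n" "A * P = P * mat_diag n \<mu>"
    and M: "\<forall>i j. i \<le> j \<longrightarrow> j < n \<longrightarrow> \<mu> i \<le> \<mu> j"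
    and "\<forall>a. eigenvalue A a \<longrightarrow> (\<exists>i<n. a = \<mu> i)"
    using symmetric_eigenbasis[OF Ac, folded \<mu>_def] .
  have mono: "\<mu> i \<le> \<mu> j" if "i \<le> j" "j < n" for i j using M that by blast
  have c_le: "c \<le> \<mu> k" if "2 \<le> k" "k < n" for k
    using c mono[of 1 k] mono[of 2 k] that by (auto simp: \<mu>_def numeral_2_eq_2 numeral_3_eq_3)
  have c_pos: "0 < c"
    using c second_eigenvalue_pos[OF n A P mono[of 0 1]] mono[of 1 2] n
    by (auto simp: \<mu>_def numeral_2_eq_2 numeral_3_eq_3)
  let ?F = "unroll n x" and ?w = "weights n A"
  have cycF: "cyclic n ?F" and cycw: "cyclic n ?w" by (rule cyclic_unroll, rule cyclic_weights)
  have pos: "\<And>i. 0 < ?w i" using weights_pos[OF n A] .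
  have Ax: "A *\<^sub>v x = c \<cdot>\<^sub>v x" and x0: "x \<noteq> 0\<^sub>v n" using ev Ac by (auto simp: eigenvector_def)
  have eig: "cycle_eigenfunction ?w c ?F" using Ax eigenvector_iff_cycle_eigenfunction[OF n A x] by simp
  obtain i0 where i0: "i0 < n" "x $ i0 \<noteq> 0" using x x0 by (metis carrier_vecD eq_vecI index_zero_vec)
  hence nz: "?F i0 \<noteq> 0" by simp
  have n0: "0 < n" using n by simp
  have y: "vec n y \<in> carrier_vec n" for y :: "nat \<Rightarrow> real" by simp
  have orth: "\<And>k. k < 2 \<Longrightarrow> k < n \<Longrightarrow> col P k \<bullet> vec n y = 0"
    if "(\<Sum>i<n. col P 0 $ i * y i) = 0" "(\<Sum>i<n. col P 1 $ i * y i) = 0" for y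
    using that by (auto simp: scalar_prod_def lessThan_atLeast0 less_2_cases_iff)
  have qf: "vec n y \<bullet> (A *\<^sub>v vec n y) = (\<Sum>i<n. ?w i * (y (Suc i) - y i)\<^sup>2)"
      "vec n y \<bullet> vec n y = (\<Sum>i<n. (y i)\<^sup>2)" if "cyclic n y" for y
    using laplacian_quadratic_form[OF n A y] vec_scalar_prod_self[OF y] unroll_vec[OF that n0] by simp_all
  have no4: False if idx: "i1 < i2" "i2 < i3" "i3 < i4" "i4 < i1 + n"
      "?F i1 < 0" "0 < ?F i2" "?F i3 < 0" "0 < ?F i4" for i1 i2 i3 i4
  proof (rule no_four_sign_changes[OF cycF cycw pos eig _ _ idx])
    fix y assume cycy: "cyclic n y" and o: "(\<Sum>i<n. col P 0 $ i * y i) = 0" "(\<Sum>i<n. col P 1 $ i * y i) = 0"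
    note rb = rayleigh_lower_bound[OF Ac(1) P c_le y orth[OF o], unfolded qf[OF cycy]]
    show "c * (\<Sum>i<n. (y i)\<^sup>2) \<le> (\<Sum>i<n. ?w i * (y (Suc i) - y i)\<^sup>2)" using rb(1) .
    show "cycle_eigenfunction ?w c y" if "c * (\<Sum>i<n. (y i)\<^sup>2) = (\<Sum>i<n. ?w i * (y (Suc i) - y i)\<^sup>2)"
      using rb(2) that eigenvector_iff_cycle_eigenfunction[OF n A y] unroll_vec[OF cycy n0] by simp
  qed
  obtain b j e d where uni: "unimodal_from n ?F b j e d"
    using unimodal_if_two_sign_changes[OF cycF cycw pos eig c_pos nz no4 n0] .
  note ud = unimodal_bounds[OF uni] and pl = unimodal_plateaus[OF cycF uni]
  have sum0: "(\<Sum>i<n. ?F i) = 0" using eigenfunction_sum_zero[OF cycF cycw eig] c_pos by simp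
  have per: "periodic n x" using periodic_if_unimodal[OF x sum0 uni] .
  define D where "D i = ?w i * (?F (Suc i) - ?F i)" for i
  have cycD: "cyclic n D"
    using cyclicD[OF cycF] cyclicD[OF cycF, of "Suc _"] cyclicD[OF cycw] unfolding D_def by (simp add: cyclic_def)
  have flux: "D i - D (Suc i) = c * ?F (Suc i)" for i
    using eig unfolding cycle_eigenfunction_def D_def by simp
  have S1: "c * (\<Sum>i\<in>cyc_oc n ((b + (n - d)) mod n) ((b + j) mod n). x $ i) = D (b + (n - d)) - D (b + j)"
    by (rule cyc_oc_flux[OF n0 cycD flux])
  have S2: "c * (\<Sum>i\<in>cyc_co n (b mod n) ((b + (j + e)) mod n). x $ i) = D (b + (n - 1)) - D (b + (j + e - 1))"
  proof -
    have "b + (j + e) + (n - 1) = b + (j + e - 1) + n" using ud n by simp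
    hence "D (b + (j + e) + (n - 1)) = D (b + (j + e - 1))" using cyclicD[OF cycD] by (simp only:)
    thus ?thesis using cyc_co_flux[OF n0 cycD flux, of b "b + (j + e)"] by simp
  qed
  have D_sgn: "D i < 0 \<longleftrightarrow> ?F (Suc i) < ?F i" "0 < D i \<longleftrightarrow> ?F i < ?F (Suc i)" "D i = 0 \<longleftrightarrow> ?F (Suc i) = ?F i" for i
    using pos[of i] unfolding D_def by (auto simp: zero_less_mult_iff mult_less_0_iff)
  note u = uni[unfolded unimodal_from_def]
  have u_down: "\<forall>k<j. ?F (Suc (b + k)) < ?F (b + k)"
    and u_up: "\<forall>k. j + e \<le> k \<and> k < n - d \<longrightarrow> ?F (b + k) < ?F (Suc (b + k))"
    using uni by (simp_all add: unimodal_from_def)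
  have Dp: "if d = 0 then D (b + (n - d)) < 0 \<and> 0 < D (b + (n - 1)) else D (b + (n - d)) = 0 \<and> D (b + (n - 1)) = 0"
  proof (cases "d = 0")
    case True
    have "D b < 0" using u_down[rule_format, of 0] ud D_sgn(1)[of b] by simp
    moreover have "D (b + n) = D b" using cyclicD[OF cycD] .
    moreover have "0 < D (b + (n - 1))" using u_up[rule_format, of "n - 1"] True ud D_sgn(2) by simp
    ultimately show ?thesis using True by simp
  next
    case False
    hence "d = 1" using ud by auto
    moreover have "Suc (b + (n - 1)) = b + n" using n by simp
    ultimately show ?thesis using u D_sgn(3)[of "b + (n - 1)"] by simp
  qed
  have Dq: "if e = 0 then 0 < D (b + j) \<and> D (b + (j + e - 1)) < 0 else D (b + j) = 0 \<and> D (b + (j + e - 1)) = 0"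
  proof (cases "e = 0")
    case True
    have "0 < D (b + j)" using u_up[rule_format, of j] True ud D_sgn(2) by simp
    moreover have "D (b + (j - 1)) < 0" using u_down[rule_format, of "j - 1"] ud D_sgn(1) by simp
    ultimately show ?thesis using True by simp
  next
    case False
    hence "e = 1" using ud by auto
    thus ?thesis using u D_sgn(3)[of "b + j"] by simp
  qed
  define s1 where "s1 = (\<Sum>i\<in>cyc_oc n ((b + (n - d)) mod n) ((b + j) mod n). x $ i)"
  define s2 where "s2 = (\<Sum>i\<in>cyc_co n (b mod n) ((b + (j + e)) mod n). x $ i)"
  have strict: "c * s1 < 0 \<and> 0 < c * s2" if "d = 0 \<or> e = 0"
  proof (cases "d = 0")
    case True
    thus ?thesis unfolding S1[folded s1_def] S2[folded s2_def]
      using Dp Dq by (cases "e = 0") (simp_all del: add_diff_assoc)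
  next
    case False
    hence "e = 0" using that by simp
    with False show ?thesis unfolding S1[folded s1_def] S2[folded s2_def] using Dp Dq by simp
  qed
  have zero: "c * s1 = 0 \<and> c * s2 = 0" if "\<not> (d = 0 \<or> e = 0)"
    unfolding S1[folded s1_def] S2[folded s2_def] using Dp Dq that by simp
  have "s1 < 0 \<and> 0 < s2" if "d = 0 \<or> e = 0"
    using strict[OF that] c_pos by (simp add: mult_less_0_iff zero_less_mult_iff)
  moreover have "s1 = 0 \<and> 0 = s2" if "\<not> (d = 0 \<or> e = 0)"
    using zero[OF that] c_pos by simp
  ultimately have "balanced n x"
    unfolding balanced_iff_unimodal[OF n uni] s1_def[symmetric] s2_def[symmetric] by presburger
  with per show ?thesis by simp
qed

text \<open>It remains to locate the eigenvalue 1. If the third eigenvalue were less than 1, some nonzero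
  combination of the first three eigenvectors would satisfy the two linear conditions of
  \<open>unimodal_energy_bound\<close> and have energy both at least and less than its squared norm. So 1 has
  at most two eigenvalues below it, and it is not the first one, which is at most 0.\<close>

lemma laplacian_for_periodic_balanced:
  assumes n: "3 \<le> n" and x: "x \<in> carrier_vec n" and per: "periodic n x" and bal: "balanced n x"
  obtains A where "A \<in> weighted_laplacians n (cycle_edges n)"
    "eigenvector A x (kth_eigenvalue 2 A) \<or> eigenvector A x (kth_eigenvalue 3 A)"
proof -
  have n0: "0 < n" using n by simp
  let ?F = "unroll n x"
  have cycF: "cyclic n ?F" by (rule cyclic_unroll)
  obtain b j e d where uni: "unimodal_from n ?F b j e d" using unimodal_if_periodic[OF n0 x per] .
  note ud = unimodal_bounds[OF uni]
  have sum0: "(\<Sum>i<n. ?F i) = 0" using per ones_scalar_prod[OF x] by (simp add: periodic_def)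
  have peak: "0 < ?F b" using unimodal_peak_pos[OF cycF uni sum0] .
  have valley: "?F (b + j) < 0" using unimodal_valley_neg[OF cycF uni sum0] .
  define D0 where "D0 i = - (\<Sum>k<Suc i. ?F k)" for i
  have flux0: "D0 (Suc i) = D0 i - ?F (Suc i)" for i by (simp add: D0_def)
  have cyc0: "cyclic n D0"
  proof (rule cyclicI)
    fix i
    have "(\<Sum>k<Suc i + m. ?F k) = (\<Sum>k<Suc i. ?F k) + (\<Sum>k<m. ?F (Suc i + k))" for m
      by (induction m) (simp_all add: ac_simps)
    hence "(\<Sum>k<Suc i + n. ?F k) = (\<Sum>k<Suc i. ?F k) + (\<Sum>k<n. ?F (Suc i + k))" .
    also have "(\<Sum>k<n. ?F (Suc i + k)) = 0" using sum_cyclic_shift[OF cycF, of "Suc i"] sum0 by simp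
    finally show "D0 (i + n) = D0 i" by (simp add: D0_def)
  qed
  have flux1: "D0 i - D0 (Suc i) = 1 * ?F (Suc i)" for i using flux0[of i] by simp
  have S1: "(\<Sum>i\<in>cyc_oc n ((b + (n - d)) mod n) ((b + j) mod n). x $ i) = D0 (b + (n - d)) - D0 (b + j)"
    using cyc_oc_flux[OF n0 cyc0 flux1, of "b + (n - d)" "b + j"] by simp
  have S2: "(\<Sum>i\<in>cyc_co n (b mod n) ((b + (j + e)) mod n). x $ i) = D0 (b + (n - 1)) - D0 (b + (j + e - 1))"
  proof -
    have "b + (j + e) + (n - 1) = b + (j + e - 1) + n" using ud n by simp
    hence "D0 (b + (j + e) + (n - 1)) = D0 (b + (j + e - 1))" using cyclicD[OF cyc0] by (simp only:)
    thus ?thesis using cyc_co_flux[OF n0 cyc0 flux1, of b "b + (j + e)"] by simp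
  qed
  have B: "if d = 0 \<or> e = 0
      then D0 (b + (n - d)) < D0 (b + j) \<and> D0 (b + (j + e - 1)) < D0 (b + (n - 1))
      else D0 (b + (n - d)) = D0 (b + j)"
    using bal unfolding balanced_iff_unimodal[OF n uni] S1 S2 by (auto split: if_splits)
  obtain c where sgn: "\<And>i. sgn (D0 i + c) = sgn (?F (Suc i) - ?F i)"
    using flux_with_gradient_signs[OF cycF uni cyc0 flux0 peak valley B] by metis
  define w where "w i = (if ?F (Suc i) = ?F i then 1 else (D0 i + c) / (?F (Suc i) - ?F i))" for i
  have cycw: "cyclic n w"
    using cyclicD[OF cycF] cyclicD[OF cycF, of "Suc _"] cyclicD[OF cyc0] unfolding w_def by (simp add: cyclic_def)
  have wpos: "0 < w i" for i
    using sgn[of i] unfolding w_def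
    by (cases "?F (Suc i) - ?F i" "0 :: real" rule: linorder_cases)
      (auto simp: sgn_if divide_neg_neg split: if_splits)
  have wflux: "w i * (?F (Suc i) - ?F i) = D0 i + c" for i
    using sgn[of i] unfolding w_def by (auto simp: sgn_0_0)
  have eig: "cycle_eigenfunction w 1 ?F"
    unfolding cycle_eigenfunction_def wflux using flux1 by simp
  obtain A where A: "A \<in> weighted_laplacians n (cycle_edges n)" and wA: "weights n A = w"
    using laplacian_with_weights[OF n cycw wpos] .
  note Ac = laplacian_props(1,2)[OF A]
  have "A *\<^sub>v x = 1 \<cdot>\<^sub>v x"
    using eig eigenvector_iff_cycle_eigenfunction[OF n A x, of 1] unfolding wA by blast
  moreover have "x \<noteq> 0\<^sub>v n"
  proof
    assume "x = 0\<^sub>v n"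
    hence "?F b = 0" using n0 by (simp add: unroll_def)
    thus False using peak by simp
  qed
  ultimately have ev: "eigenvector A x 1" using Ac x by (simp add: eigenvector_def)
  define \<mu> where "\<mu> i = kth_eigenvalue (Suc i) A" for i
  obtain P where P: "P \<in> carrier_mat n n" "transpose_mat P * P = 1\<^sub>m n" "A * P = P * mat_diag n \<mu>"
    and M: "\<forall>i j. i \<le> j \<longrightarrow> j < n \<longrightarrow> \<mu> i \<le> \<mu> j"
    and S: "\<forall>a. eigenvalue A a \<longrightarrow> (\<exists>i<n. a = \<mu> i)"
    using symmetric_eigenbasis[OF Ac, folded \<mu>_def] .
  have mono: "\<mu> i \<le> \<mu> j" if "i \<le> j" "j < n" for i j using M that by blast
  have spec: "\<exists>i<n. a = \<mu> i" if "eigenvalue A a" for a using S that by blast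
  have mu2: "1 \<le> \<mu> 2"
  proof (rule ccontr)
    assume lt: "\<not> 1 \<le> \<mu> 2"
    obtain t1 t2 where energy: "\<forall>y. cyclic n y \<longrightarrow> y t1 * ?F (Suc t1) = y (Suc t1) * ?F t1 \<longrightarrow>
       y t2 * ?F (Suc t2) = y (Suc t2) * ?F t2 \<longrightarrow>
       1 * (\<Sum>i<n. (y i)\<^sup>2) \<le> (\<Sum>i<n. w i * (y (Suc i) - y i)\<^sup>2)"
      using unimodal_energy_bound[OF cycF uni peak valley cycw wpos eig] .
    define g where "g t k = unroll n (col P k) t * ?F (Suc t) - unroll n (col P k) (Suc t) * ?F t" for t k
    obtain \<alpha> \<beta> \<gamma> where nz: "\<alpha> \<noteq> 0 \<or> \<beta> \<noteq> 0 \<or> \<gamma> \<noteq> 0"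
      and lin: "g t1 0 * \<alpha> + g t1 1 * \<beta> + g t1 2 * \<gamma> = 0" "g t2 0 * \<alpha> + g t2 1 * \<beta> + g t2 2 * \<gamma> = 0"
      using two_linear_equations_three_unknowns[of "g t1 0" "g t1 1" "g t1 2" "g t2 0" "g t2 1" "g t2 2"] by metis
    define z where "z = vec n (\<lambda>k. if k = 0 then \<alpha> else if k = 1 then \<beta> else if k = 2 then \<gamma> else 0)"
    have z: "z \<in> carrier_vec n" by (simp add: z_def)
    define y where "y = P *\<^sub>v z"
    have y: "y \<in> carrier_vec n" unfolding y_def using P z by auto
    have yval: "unroll n y t = \<alpha> * unroll n (col P 0) t + \<beta> * unroll n (col P 1) t + \<gamma> * unroll n (col P 2) t" for t
    proof -
      have t: "t mod n < n" using n0 by simp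
      have "unroll n y t = (\<Sum>k<n. P $$ (t mod n, k) * z $ k)"
        using t P z by (simp add: unroll_def y_def scalar_prod_def lessThan_atLeast0)
      also have "\<dots> = (\<Sum>k\<in>{0, 1, 2}. P $$ (t mod n, k) * z $ k)"
        by (rule sum.mono_neutral_right) (use n in \<open>auto simp: z_def\<close>)
      also have "\<dots> = \<alpha> * unroll n (col P 0) t + \<beta> * unroll n (col P 1) t + \<gamma> * unroll n (col P 2) t"
        using t P n by (simp add: z_def unroll_def)
      finally show ?thesis .
    qed
    have cycy: "cyclic n (unroll n y)" by (rule cyclic_unroll)
    have "y \<bullet> y \<le> y \<bullet> (A *\<^sub>v y)"
      using energy[rule_format, OF cycy] lin
      unfolding laplacian_quadratic_form[OF n A y] vec_scalar_prod_self[OF y] wA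
      by (simp add: yval g_def algebra_simps)
    moreover have "y \<bullet> (A *\<^sub>v y) \<le> \<mu> 2 * (y \<bullet> y)"
      unfolding y_def
    proof (rule rayleigh_upper_bound[OF Ac(1) P _ z])
      fix k assume "k < n" "z $ k \<noteq> 0"
      hence "k \<le> 2" by (auto simp: z_def split: if_splits)
      thus "\<mu> k \<le> \<mu> 2" using mono[of k 2] n by simp
    qed
    moreover have "0 < y \<bullet> y"
    proof -
      have "y \<bullet> y = (\<Sum>k<n. (z $ k)\<^sup>2)"
        unfolding y_def using eigenbasis_quadratic_form(2)[OF Ac(1) P z] .
      moreover obtain k where "k < n" "z $ k \<noteq> 0"
      proof -
        have "z $ 0 \<noteq> 0 \<or> z $ 1 \<noteq> 0 \<or> z $ 2 \<noteq> 0" using nz n by (simp add: z_def)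
        moreover have "0 < n" "1 < n" "2 < n" using n by auto
        ultimately show thesis using that by blast
      qed
      ultimately show ?thesis by (simp add: sum_pos2[of _ k])
    qed
    moreover from this lt have "\<mu> 2 * (y \<bullet> y) < 1 * (y \<bullet> y)"
      by (intro mult_strict_right_mono) simp_all
    ultimately show False by simp
  qed
  have "eigenvalue A 1" using ev unfolding eigenvalue_def by blast
  then obtain k where k: "k < n" "1 = \<mu> k" using spec by blast
  have "k \<noteq> 0"
  proof
    assume "k = 0"
    have "eigenvector A (ones_vec n) 0"
    proof -
      have "A *\<^sub>v ones_vec n = 0\<^sub>v n" using A by (simp add: weighted_laplacians_def)
      moreover have "ones_vec n \<noteq> 0\<^sub>v n" using n0 by (auto simp: ones_vec_def vec_eq_iff)
      ultimately show ?thesis using Ac by (auto simp: eigenvector_def ones_vec_def)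
    qed
    then obtain l where "l < n" "0 = \<mu> l" using spec unfolding eigenvalue_def by blast
    thus False using mono[of 0 l] k \<open>k = 0\<close> by simp
  qed
  have "\<mu> 1 = 1 \<or> \<mu> 2 = 1"
  proof (cases "k = 1")
    case False
    hence "\<mu> 2 \<le> \<mu> k" using k \<open>k \<noteq> 0\<close> by (intro mono) auto
    thus ?thesis using mu2 k by simp
  qed (use k in simp)
  hence "1 = kth_eigenvalue 2 A \<or> 1 = kth_eigenvalue 3 A"
    by (auto simp: \<mu>_def numeral_2_eq_2 numeral_3_eq_3)
  hence "eigenvector A x (kth_eigenvalue 2 A) \<or> eigenvector A x (kth_eigenvalue 3 A)"
    using ev by auto
  with A show thesis by (rule that)
qed

theorem theorem4p9:
  fixes n :: nat and x :: "real vec"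
  assumes "n \<ge> 3" and "x \<in> carrier_vec n"
  shows "(\<exists>A \<in> weighted_laplacians n (cycle_edges n).
            eigenvector A x (kth_eigenvalue 2 A) \<or> eigenvector A x (kth_eigenvalue 3 A))
         \<longleftrightarrow> periodic n x \<and> balanced n x"
proof
  assume "\<exists>A \<in> weighted_laplacians n (cycle_edges n).
    eigenvector A x (kth_eigenvalue 2 A) \<or> eigenvector A x (kth_eigenvalue 3 A)"
  then obtain A c where "A \<in> weighted_laplacians n (cycle_edges n)" "eigenvector A x c"
    "c = kth_eigenvalue 2 A \<or> c = kth_eigenvalue 3 A" by blast
  thus "periodic n x \<and> balanced n x"
    by (rule periodic_balanced_if_eigenvector[OF assms])
next
  assume "periodic n x \<and> balanced n x"
  hence per: "periodic n x" and bal: "balanced n x" by simp_all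
  obtain A where "A \<in> weighted_laplacians n (cycle_edges n)"
    "eigenvector A x (kth_eigenvalue 2 A) \<or> eigenvector A x (kth_eigenvalue 3 A)"
    using laplacian_for_periodic_balanced[OF assms per bal] .
  thus "\<exists>A \<in> weighted_laplacians n (cycle_edges n).
    eigenvector A x (kth_eigenvalue 2 A) \<or> eigenvector A x (kth_eigenvalue 3 A)" by blast
qed

end
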